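(* Let $d\ge 1$ be an integer and let $\psi\in\Psi_d$ have $d$-Schoenberg sequence $(b_{n,d})_{n\in\mathbb{N}_0}$. Suppose that $\psi$ is not identically equal to $1$. Put $$G_2:=\sum_{n=0}^\infty b_{n+1,d}(n+1)(n+d)\in[0,\infty].$$ (a) The descente $D_S\psi$ is well-defined and $D_S\psi\in\Psi_{d+2}$ if and only if $G_2<\infty$. In this case, $D_S\psi$ has $(d+2)$-Schoenberg sequence $(c_{n,d+2})_{n\in\mathbb{N}_0}$ with $c_{n,d+2}=b_{n+1,d}(n+1)(n+d)/G_2$. (b) The condition $G_2<\infty$ is equivalent to $|\psi''(0)|<\infty$ (i.e. to the existence of $\psi''(0)$ as a finite number).
   Context: For an integer $d\ge 1$, $\mathbb{S}^d=\{x\in\mathbb{R}^{d+1}:\|x\|=1\}$ and $\theta(x,y)=\arccos(\langle x,y\rangle)$ for $x,y\in\mathbb{S}^d$. A function $g:\mathbb{S}^d\times\mathbb{S}^d\to\mathbb{R}$ is positive definite if $\sum_{i=1}^n\sum_{j=1}^n c_ic_j g(x_i,x_j)\ge 0$ for all $n \ge 1$, $x_i\in\mathbb{S}^d$, $c_i\in\mathbb{R}$. $\Psi_d$ is the class of continuous $\psi:[0,\pi]\to\mathbb{R}$ with $\psi(0)=1$ such that $g(x,y)=\psi(\theta(x,y))$ is positive definite on $\mathbb{S}^d$. Gegenbauer polynomials: for $\lambda>0$, $(1+r^2-2r\cos\theta)^{-\lambda}=\sum_{n=0}^\infty r^nC_n^\lambda(\cos\theta)$ for $r\in(-1,1)$,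 $\theta\in[0,\pi]$; for $\lambda=0$, $C_n^0(\cos\theta)=\cos(n\theta)$. By Schoenberg's theorem, $\psi\in\Psi_d$ if and only if $\psi(\theta)=\sum_{n=0}^\infty b_{n,d}\,C_n^{(d-1)/2}(\cos\theta)/C_n^{(d-1)/2}(1)$, $\theta\in[0,\pi]$, with coefficients $b_{n,d}\ge 0$, $\sum_{n=0}^\infty b_{n,d}=1$; the (unique) sequence $(b_{n,d})_{n\in\mathbb{N}_0}$ is the $d$-Schoenberg sequence of $\psi$. Derivatives of $\psi$ at $0$ are those of the even continuation $\theta\mapsto\psi(|\theta|)$, $\theta\in[-\pi,\pi]$, at $\theta=0$. Descente on spheres: if $\psi:[0,\pi]\to\mathbb{R}$ is differentiable and has a finite second derivative $\psi''(0)\ne 0$ (this is what "well-defined" means), then $$D_S\psi(\theta):=\frac{\psi'(\theta)}{\sin(\theta)\,\psi''(0)},\quad\theta\in(0,\pi).$$ The statement $D_S\psi\in\Psi_{d+2}$ is understood for the continuous extension of $D_S\psi$ to $[0,\pi]$. *)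

theory Defs
  imports "HOL-Analysis.Analysis"
begin

text \<open>
  The sphere \<open>S^d\<close> is the carrier \<open>topspace (nsphere d)\<close> of the library's sphere: the sequences
  \<open>x :: nat \<Rightarrow> real\<close> with \<open>x i = 0\<close> for \<open>i > d\<close> and \<open>(\<Sum>i\<le>d. x i ^ 2) = 1\<close>.  This represents the
  unit sphere of \<open>R^(d+1)\<close> with \<open>d\<close> an ordinary natural number, as needed to relate \<open>S^d\<close> and
  \<open>S^(d+2)\<close>.
\<close>

definition geodesic_dist :: "nat \<Rightarrow> (nat \<Rightarrow> real) \<Rightarrow> (nat \<Rightarrow> real) \<Rightarrow> real" where
  "geodesic_dist d x y = arccos (\<Sum>i\<le>d. x i * y i)"

definition positive_definite_on :: "'a set \<Rightarrow> ('a \<Rightarrow> 'a \<Rightarrow> real) \<Rightarrow> bool" where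
  "positive_definite_on S g \<longleftrightarrow>
     (\<forall>n\<ge>1. \<forall>(x :: nat \<Rightarrow> 'a) (c :: nat \<Rightarrow> real). (\<forall>i\<in>{1..n}. x i \<in> S) \<longrightarrow>
        (\<Sum>i=1..n. \<Sum>j=1..n. c i * c j * g (x i) (x j)) \<ge> 0)"

text \<open>
  Functions on \<open>[0,\<pi>]\<close> are represented by functions \<open>real \<Rightarrow> real\<close> whose values outside
  \<open>{0..pi}\<close> are irrelevant.
\<close>

definition Psi :: "nat \<Rightarrow> (real \<Rightarrow> real) set" where
  "Psi d = {\<psi>. continuous_on {0..pi} \<psi> \<and> \<psi> 0 = 1 \<and>
     positive_definite_on (topspace (nsphere d)) (\<lambda>x y. \<psi> (geodesic_dist d x y))}"

text \<open>
  \<open>gegenbauer l n x\<close> is \<open>C_n^l(x)\<close> for \<open>l \<ge> 0\<close> and \<open>x \<in> [-1,1]\<close>: for \<open>l > 0\<close> the coefficient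
  of \<open>r^n\<close> in the generating function \<open>(1 + r^2 - 2 r x)^(-l)\<close>, \<open>r \<in> (-1,1)\<close> (power series
  coefficients are unique), and for \<open>l = 0\<close> determined by \<open>C_n^0(cos \<theta>) = cos (n \<theta>)\<close>.
\<close>

definition gegenbauer :: "real \<Rightarrow> nat \<Rightarrow> real \<Rightarrow> real" where
  "gegenbauer l n x =
     (if l = 0 then cos (real n * arccos x)
      else (THE c :: nat \<Rightarrow> real. \<forall>r\<in>{-1<..<1}.
              (\<lambda>k. r ^ k * c k) sums ((1 + r\<^sup>2 - 2 * r * x) powr (-l))) n)"

definition schoenberg_seq :: "nat \<Rightarrow> (real \<Rightarrow> real) \<Rightarrow> (nat \<Rightarrow> real) \<Rightarrow> bool" where
  "schoenberg_seq d \<psi> b \<longleftrightarrow>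
     (\<forall>n. b n \<ge> 0) \<and> b sums 1 \<and>
     (\<forall>\<theta>\<in>{0..pi}.
        (\<lambda>n. b n * (gegenbauer ((real d - 1) / 2) n (cos \<theta>) / gegenbauer ((real d - 1) / 2) n 1))
          sums \<psi> \<theta>)"

text \<open>Derivatives at \<open>0\<close> are those of the even continuation.\<close>

definition even_cont :: "(real \<Rightarrow> real) \<Rightarrow> real \<Rightarrow> real" where
  "even_cont \<psi> t = \<psi> \<bar>t\<bar>"

definition has_second_deriv_at_0 :: "(real \<Rightarrow> real) \<Rightarrow> bool" where
  "has_second_deriv_at_0 \<psi> \<longleftrightarrow>
     (\<forall>\<^sub>F t in nhds 0. even_cont \<psi> differentiable (at t)) \<and>
     deriv (even_cont \<psi>) differentiable (at 0)"

definition second_deriv_at_0 :: "(real \<Rightarrow> real) \<Rightarrow> real" where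
  "second_deriv_at_0 \<psi> = deriv (deriv (even_cont \<psi>)) 0"

text \<open>
  Differentiability on \<open>{0..pi}\<close> is one-sided at \<open>pi\<close>; at \<open>0\<close>, differentiability of the even
  continuation is part of \<open>has_second_deriv_at_0\<close>.
\<close>

definition descente_well_defined :: "(real \<Rightarrow> real) \<Rightarrow> bool" where
  "descente_well_defined \<psi> \<longleftrightarrow>
     \<psi> differentiable_on {0..pi} \<and> has_second_deriv_at_0 \<psi> \<and> second_deriv_at_0 \<psi> \<noteq> 0"

definition descente_open :: "(real \<Rightarrow> real) \<Rightarrow> real \<Rightarrow> real" where
  "descente_open \<psi> \<theta> = deriv \<psi> \<theta> / (sin \<theta> * second_deriv_at_0 \<psi>)"

text \<open>
  The extension of the descente from \<open>(0,\<pi>)\<close> to \<open>[0,\<pi>]\<close> by its limits at the end points.  If a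
  limit does not exist, the value there is arbitrary and the extension is not continuous on
  \<open>{0..pi}\<close>, hence in no class \<open>Psi d\<close>.
\<close>

definition descente :: "(real \<Rightarrow> real) \<Rightarrow> real \<Rightarrow> real" where
  "descente \<psi> \<theta> =
     (if \<theta> \<in> {0<..<pi} then descente_open \<psi> \<theta>
      else Lim (at \<theta> within {0<..<pi}) (descente_open \<psi>))"

definition G2 :: "nat \<Rightarrow> (nat \<Rightarrow> real) \<Rightarrow> ennreal" where
  "G2 d b = (\<Sum>n. ennreal (b (n + 1) * real (n + 1) * real (n + d)))"

end

theory Submission
  imports Defs
begin

text \<open>
  The derivative of \<open>C_n^l (cos \<theta>)\<close> is \<open>- 2 l sin \<theta> C_(n-1)^(l+1) (cos \<theta>)\<close>, so differentiating the
  Schoenberg expansion of \<open>\<psi>\<close> term by term yields \<open>- sin \<theta>\<close> times an expansion for dimension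
  \<open>d + 2\<close> with coefficients proportional to \<open>b (n + 1) (n + 1) (n + d)\<close>.  If \<open>G2\<close> is finite, this
  is justified by uniform convergence, and \<open>\<psi>'' 0 = - G2 / d\<close>.  Conversely, if \<open>\<psi>'' 0\<close> exists, then
  \<open>(1 - \<psi> t) / t^2\<close> has a finite limit, which bounds the partial sums of \<open>G2\<close>.  The membership
  in \<open>Psi (d + 2)\<close> rests on the easy half of Schoenberg's theorem: \<open>C_n^((d-1)/2)\<close> of the inner
  product is positive definite on \<open>S^d\<close>, because it is the Gram kernel, in the Fischer inner
  product, of the harmonic projections of the polynomials \<open>\<langle>x, y\<rangle>^n\<close>.
\<close>

section \<open>Gegenbauer polynomials\<close>

text \<open>The constants come from geometry: k (k + d - 1) is the eigenvalue of minus the spherical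
  Laplacian in degree k, and for a function of the distance to a pole the Laplacian at the pole is d
  times the second derivative. So the normalised function of degree k = n + 1 has second derivative
  -(n + 1)(n + d)/d at 0, and \<open>G2\<close> is -d times the sum of these numbers weighted by b.
  The obstacle is to recover this sum from the mere existence of psi'' at one point, where the
  series cannot yet be differentiated termwise; the sign of each term, due to the bound of the
  normalised functions by 1, makes up for it. The definite description in \<open>gegenbauer\<close>
  permits no computation, hence the explicit polynomials. Dimension 1 has parameter 0, where they
  degenerate, and is handled by cosines; the target dimension d + 2 has a positive parameter, and
  positive definiteness is proved for such parameters. That psi is not identically 1 gives
  \<open>G2\<close> > 0, so psi'' at 0 is nonzero and the normalisation is legitimate.\<close>

definition geg_coeff :: "real \<Rightarrow> nat \<Rightarrow> nat \<Rightarrow> real" where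
  "geg_coeff l n k =
     (if 2 * k \<le> n then (-1) ^ k * pochhammer l (n - k) / (fact k * fact (n - 2 * k)) else 0)"

text \<open>The classical explicit formula. Since \<open>geg_coeff\<close> vanishes for 2 k > n, the
  upper limit may be raised at will, which lets sums of different degrees be compared over one
  range.\<close>

definition gegpoly :: "real \<Rightarrow> nat \<Rightarrow> real \<Rightarrow> real" where
  "gegpoly l n x = (\<Sum>k\<le>n. geg_coeff l n k * (2 * x) ^ (n - 2 * k))"

lemma gegpoly_eq_sum:
  assumes "n \<le> N"
  shows "gegpoly l n x = (\<Sum>k\<le>N. geg_coeff l n k * (2 * x) ^ (n - 2 * k))"
  unfolding gegpoly_def
  by (rule sum.mono_neutral_left) (use assms in \<open>auto simp: geg_coeff_def\<close>)

lemma gegpoly_0 [simp]: "gegpoly l 0 x = 1"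
  by (simp add: gegpoly_def geg_coeff_def)

lemma gegpoly_1 [simp]: "gegpoly l (Suc 0) x = 2 * l * x"
  by (simp add: gegpoly_def geg_coeff_def)

text \<open>This and the next lemma compare coefficients of (2x)^(n + 2 - 2k) in the three-term
  recurrence. The degree n polynomial contributes with its index shifted by one, hence nothing for k
  = 0.\<close>

lemma geg_coeff_rec_0:
  "real (n + 2) * geg_coeff l (n + 2) 0 = (real n + 1 + l) * geg_coeff l (n + 1) 0"
  by (simp add: geg_coeff_def pochhammer_rec' field_simps del: of_nat_Suc) (simp add: field_simps)

lemma geg_coeff_rec_Suc:
  "real (n + 2) * geg_coeff l (n + 2) (Suc j) =
     (real n + 1 + l) * geg_coeff l (n + 1) (Suc j) - (real n + 2 * l) * geg_coeff l n j"
proof (cases "2 * j \<le> n")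
  case True
  then obtain m where n: "n = 2 * j + m" using le_Suc_ex by blast
  have e: "n - j = j + m" "Suc n - j = Suc (j + m)" "n - 2 * j = m" using n by auto
  define p where "p = pochhammer l (j + m)"
  define f where "f = (fact j :: real)"
  define g where "g = (fact m :: real)"
  have pos: "f \<noteq> 0" "g \<noteq> 0" by (simp_all add: f_def g_def)
  have c2: "geg_coeff l (n + 2) (Suc j) = - ((-1) ^ j) * (p * (l + real j + real m)) / ((real j + 1) * f * g)"
    by (simp add: geg_coeff_def e True pochhammer_Suc p_def f_def g_def add_ac)
  have c1: "geg_coeff l (n + 1) (Suc j) = - ((-1) ^ j) * p * real m / ((real j + 1) * f * g)"
  proof (cases m)
    case (Suc m')
    have "n + 1 - Suc j = j + m" "n + 1 - 2 * Suc j = m'" "2 * Suc j \<le> n + 1" using n Suc by auto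
    then have "geg_coeff l (n + 1) (Suc j) = - ((-1) ^ j) * p / ((real j + 1) * f * fact m')"
      by (simp add: geg_coeff_def p_def f_def add_ac)
    moreover have "g = real m * fact m'" by (simp add: g_def Suc)
    ultimately show ?thesis using Suc by (simp del: of_nat_Suc)
  qed (simp add: geg_coeff_def n)
  have c0: "geg_coeff l n j = (-1) ^ j * p / (f * g)"
    by (simp add: geg_coeff_def e True p_def f_def g_def)
  have rn: "real n = 2 * real j + real m" by (simp add: n)
  show ?thesis unfolding c2 c1 c0 of_nat_add rn using pos
    by (simp add: divide_simps) (simp add: algebra_simps)
qed (simp add: geg_coeff_def)

lemma gegpoly_rec:
  "real (n + 2) * gegpoly l (n + 2) x =
     2 * (real n + 1 + l) * x * gegpoly l (n + 1) x - (real n + 2 * l) * gegpoly l n x"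
proof -
  let ?y = "2 * x"
  have a: "2 * (real n + 1 + l) * x * gegpoly l (n + 1) x =
      (\<Sum>k\<le>Suc (n+1). (real n + 1 + l) * geg_coeff l (n+1) k * ?y ^ (n + 2 - 2 * k))"
    unfolding gegpoly_eq_sum[OF le_SucI[OF order.refl, of "n+1"]] sum_distrib_left
  proof (intro sum.cong refl)
    fix k
    show "2 * (real n + 1 + l) * x * (geg_coeff l (n + 1) k * ?y ^ (n + 1 - 2 * k)) =
      (real n + 1 + l) * geg_coeff l (n+1) k * ?y ^ (n + 2 - 2 * k)"
    \<comment> \<open>For larger k the truncated exponents no longer match, but the coefficient is
      0.\<close>
    proof (cases "2 * k \<le> n + 1")
      case True
      then have "n + 2 - 2 * k = Suc (n + 1 - 2 * k)" by simp
      then show ?thesis by (simp add: mult_ac)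
    qed (simp add: geg_coeff_def)
  qed
  have b: "(real n + 2 * l) * gegpoly l n x =
      (\<Sum>j\<le>n + 1. (real n + 2 * l) * geg_coeff l n j * ?y ^ (n + 2 - 2 * Suc j))"
    unfolding gegpoly_eq_sum[OF le_add1[of n 1]] sum_distrib_left by (simp add: mult_ac)
  have "real (n + 2) * gegpoly l (n + 2) x =
     (\<Sum>k\<le>Suc (n+1). real (n + 2) * geg_coeff l (n + 2) k * ?y ^ (n + 2 - 2 * k))"
    unfolding gegpoly_def sum_distrib_left by (simp add: mult_ac)
  also have "\<dots> = 2 * (real n + 1 + l) * x * gegpoly l (n + 1) x - (real n + 2 * l) * gegpoly l n x"
    unfolding a b sum.atMost_Suc_shift[of _ "n+1"] geg_coeff_rec_0 geg_coeff_rec_Suc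
    by (simp only: left_diff_distrib sum_subtractf)
  finally show ?thesis .
qed

text \<open>Termwise: the exponent cancels against the factorial, and the first factor l of the
  Pochhammer symbol splits off, leaving one with parameter l + 1.\<close>

lemma gegpoly_deriv:
  "(gegpoly l (Suc n) has_real_derivative 2 * l * gegpoly (l + 1) n x) (at x)"
proof -
  have "(gegpoly l (Suc n) has_real_derivative
     (\<Sum>k\<le>Suc n. geg_coeff l (Suc n) k * (real (Suc n - 2 * k) * (2 * (2 * x) ^ (Suc n - 2 * k - 1))))) (at x)"
    unfolding gegpoly_def
    by (intro DERIV_sum DERIV_cmult DERIV_power[THEN DERIV_cong]) (auto intro!: derivative_eq_intros)
  also have "(\<Sum>k\<le>Suc n. geg_coeff l (Suc n) k * (real (Suc n - 2 * k) * (2 * (2 * x) ^ (Suc n - 2 * k - 1))))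
     = (\<Sum>k\<le>Suc n. 2 * l * (geg_coeff (l + 1) n k * (2 * x) ^ (n - 2 * k)))"
  proof (intro sum.cong refl)
    fix k
    \<comment> \<open>At 2 k = n + 1 the left side dies by its exponent 0, the right side by the
      convention in \<open>geg_coeff\<close>.\<close>
    consider "2 * k \<le> n" | "2 * k = Suc n" | "2 * k > Suc n" by linarith
    then show "geg_coeff l (Suc n) k * (real (Suc n - 2 * k) * (2 * (2 * x) ^ (Suc n - 2 * k - 1))) =
        2 * l * (geg_coeff (l + 1) n k * (2 * x) ^ (n - 2 * k))"
    proof cases
      case 1
      then have "Suc n - 2 * k = Suc (n - 2 * k)" "Suc n - k = Suc (n - k)" by auto
      with 1 show ?thesis
        by (simp add: geg_coeff_def pochhammer_rec del: of_nat_Suc)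
    qed (simp_all add: geg_coeff_def)
  qed
  also have "\<dots> = 2 * l * gegpoly (l + 1) n x"
    by (simp only: gegpoly_eq_sum[OF le_SucI[OF order.refl]] sum_distrib_left)
  finally show ?thesis .
qed

section \<open>The generating function\<close>

text \<open>
  The series of \<open>(1 - u z) ^ (- l)\<close>.  For \<open>x = cos t\<close> and \<open>u = cis t\<close>, the generating function
  factors into the series for \<open>u\<close> and \<open>cnj u\<close>; this gives both its convergence and, the
  coefficients being positive, the bound of \<open>gegpoly\<close> by its value at \<open>1\<close>.
\<close>

definition binomial_fps :: "real \<Rightarrow> complex \<Rightarrow> complex fps" where
  "binomial_fps l u = Abs_fps (\<lambda>k. of_real (pochhammer l k / fact k) * u ^ k)"

text \<open>The differential equation of (1 - u X)^(-l), which encodes this power without defining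
  real powers of formal series.\<close>

lemma binomial_fps_ode: "(1 - fps_const u * fps_X) * fps_deriv (binomial_fps l u) = fps_const (of_real l * u) * binomial_fps l u"
proof (rule fps_ext)
  fix n
  show "fps_nth ((1 - fps_const u * fps_X) * fps_deriv (binomial_fps l u)) n = fps_nth (fps_const (of_real l * u) * binomial_fps l u) n"
    by (cases n) (simp_all add: binomial_fps_def left_diff_distrib mult.assoc pochhammer_Suc
        divide_simps of_nat_Suc[symmetric] del: of_nat_Suc, simp add: algebra_simps)
qed

text \<open>The product satisfies (1 - 2 x X + X^2) P' = 2 l (x - X) P. Comparing coefficients gives
  the recurrence of \<open>gegpoly_rec\<close>, so agreement in degrees 0 and 1 suffices.\<close>

lemma binomial_fps_prod_nth:
  assumes uv: "u * v = 1" "u + v = of_real (2 * x)"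
  shows "fps_nth (binomial_fps l u * binomial_fps l v) n = of_real (gegpoly l n x)"
proof -
  define P where "P = binomial_fps l u * binomial_fps l v"
  let ?u = "fps_const u" and ?v = "fps_const v" and ?l = "fps_const (of_real l :: complex)"
  \<comment> \<open>The logarithmic derivatives of the two factors add; this is that fact with
    denominators cleared.\<close>
  have gen: "(1 - U * X) * (1 - V * X) * (F' * G + F * G') = L * (U + V - 2 * (U * V) * X) * (F * G)"
    if "(1 - U * X) * F' = L * U * F" "(1 - V * X) * G' = L * V * G" for U V X F G F' G' L :: "complex fps"
  proof -
    have "(1 - U * X) * (1 - V * X) * (F' * G + F * G') =
       (1 - V * X) * G * ((1 - U * X) * F') + (1 - U * X) * F * ((1 - V * X) * G')"
      by (simp add: algebra_simps)
    also have "\<dots> = L * (U + V - 2 * (U * V) * X) * (F * G)"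
      unfolding that by (simp add: algebra_simps)
    finally show ?thesis .
  qed
  have gen2: "(1 - U * X) * (1 - V * X) = 1 - (U + V) * X + U * V * (X * X)" for U V X :: "complex fps"
    by (simp add: algebra_simps)
  have U: "(1 - ?u * fps_X) * fps_deriv (binomial_fps l u) = ?l * ?u * binomial_fps l u"
   and V: "(1 - ?v * fps_X) * fps_deriv (binomial_fps l v) = ?l * ?v * binomial_fps l v"
    by (simp_all add: binomial_fps_ode)
  have "(1 - ?u * fps_X) * (1 - ?v * fps_X) * fps_deriv P =
     ?l * (?u + ?v - 2 * (?u * ?v) * fps_X) * P"
    unfolding P_def fps_deriv_mult using gen[OF U V] by (simp only: add.commute)
  moreover have "(1 - ?u * fps_X) * (1 - ?v * fps_X) = 1 - (?u + ?v) * fps_X + ?u * ?v * fps_X^2"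
    unfolding power2_eq_square by (rule gen2)
  moreover have "?u * ?v = 1" "?u + ?v = fps_const (of_real (2*x))" using uv by auto
  ultimately have ode: "(1 - fps_const (of_real (2*x)) * fps_X + fps_X^2) * fps_deriv P =
     ?l * (fps_const (of_real (2*x)) - 2 * fps_X) * P" by simp
  have rec: "of_nat (n + 2) * fps_nth P (n + 2) = of_real (2 * (real n + 1 + l) * x) * fps_nth P (n + 1)
     - of_real (real n + 2 * l) * fps_nth P n" for n
  proof -
    have "fps_nth ((1 - fps_const (of_real (2*x)) * fps_X + fps_X^2) * fps_deriv P) (Suc n) =
      fps_nth (?l * (fps_const (of_real (2*x)) - 2 * fps_X) * P) (Suc n)" by (simp only: ode)
    then show ?thesis
      by (cases n) (simp_all add: algebra_simps fps_X_power_mult_nth numeral_fps_const power2_eq_square)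
  qed
  have P0: "fps_nth P 0 = 1" by (simp add: P_def binomial_fps_def)
  have P1: "fps_nth P (Suc 0) = of_real (2 * l * x)"
  proof -
    have "fps_nth P (Suc 0) = of_real l * (u + v)"
      by (simp add: P_def binomial_fps_def fps_mult_nth distrib_left add.commute)
    then show ?thesis by (simp add: uv mult_ac)
  qed
  have "fps_nth P n = of_real (gegpoly l n x) \<and> fps_nth P (n + 1) = of_real (gegpoly l (n + 1) x)"
  proof (induction n)
    case (Suc n)
    then have "of_nat (n + 2) * fps_nth P (n + 2) = complex_of_real (real (n + 2) * gegpoly l (n + 2) x)"
      unfolding rec gegpoly_rec by simp
    then have "fps_nth P (n + 2) = complex_of_real (gegpoly l (n + 2) x)"
      by (simp only: of_real_mult of_real_of_nat_eq mult_cancel_left of_nat_eq_0_iff) simp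
    with Suc show ?case by simp
  qed (simp_all add: P0 P1)
  then show ?thesis by (simp add: P_def)
qed

lemma unit_complex_with_real_part:
  assumes "\<bar>x\<bar> \<le> 1"
  obtains u :: complex where "norm u = 1" "u * cnj u = 1" "u + cnj u = of_real (2 * x)"
proof
  let ?u = "cis (arccos x)"
  show "norm ?u = 1" by simp
  show "?u * cnj ?u = 1" by (simp add: complex_norm_square[symmetric])
  show "?u + cnj ?u = of_real (2 * x)" using assms by (simp add: complex_add_cnj cos_arccos_abs)
qed

lemma gegpoly_bound:
  assumes "\<bar>x\<bar> \<le> 1" "l > 0"
  shows "\<bar>gegpoly l n x\<bar> \<le> gegpoly l n 1"
proof -
  obtain u :: complex where u: "norm u = 1" "u * cnj u = 1" "u + cnj u = of_real (2 * x)"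
    using unit_complex_with_real_part[OF assms(1)] by blast
  define a where "a k = pochhammer l k / fact k" for k
  have a: "a k \<ge> 0" for k unfolding a_def using pochhammer_pos[OF assms(2), of k] by simp
  have s: "of_real (gegpoly l n x) = (\<Sum>k=0..n. of_real (a k) * u ^ k * (of_real (a (n - k)) * cnj u ^ (n - k)))"
    using binomial_fps_prod_nth[OF u(2,3), of l n] by (simp add: fps_mult_nth binomial_fps_def a_def)
  \<comment> \<open>The point x = 1 corresponds to u = 1: the same sum with all phases
    removed.\<close>
  have "of_real (gegpoly l n 1) = (\<Sum>k=0..n. of_real (a k) * 1 ^ k * (of_real (a (n - k)) * 1 ^ (n - k)) :: complex)"
    using binomial_fps_prod_nth[of 1 1 1 l n] by (simp add: fps_mult_nth binomial_fps_def a_def)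
  then have s1: "gegpoly l n 1 = (\<Sum>k=0..n. a k * a (n - k))"
    by (simp flip: of_real_mult of_real_sum)
  have "\<bar>gegpoly l n x\<bar> = norm (of_real (gegpoly l n x) :: complex)" by simp
  also have "\<dots> \<le> (\<Sum>k=0..n. norm (of_real (a k) * u ^ k * (of_real (a (n - k)) * cnj u ^ (n - k))))"
    unfolding s by (rule norm_sum)
  also have "\<dots> = gegpoly l n 1" unfolding s1 by (intro sum.cong) (simp_all add: norm_mult norm_power u a)
  finally show ?thesis .
qed

lemma binomial_series_sums:
  fixes z :: complex
  assumes "norm z < 1"
  shows "(\<lambda>k. of_real (pochhammer l k / fact k) * z ^ k) sums ((1 - z) powr of_real (-l))"
    and "summable (\<lambda>k. norm (of_real (pochhammer l k / fact k) * z ^ k))"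
proof -
  have *: "(of_real (-l) gchoose k) * (- z) ^ k = of_real (pochhammer l k / fact k) * z ^ k" for k
  proof -
    have "(complex_of_real (-l) gchoose k) = (-1) ^ k * of_real (pochhammer l k / fact k)"
      by (simp add: gbinomial_pochhammer pochhammer_of_real)
    moreover have "(-1) ^ k * (- z) ^ k = z ^ k" by (simp flip: power_mult_distrib)
    ultimately show ?thesis by (metis mult.assoc mult.commute)
  qed
  show "(\<lambda>k. of_real (pochhammer l k / fact k) * z ^ k) sums ((1 - z) powr of_real (-l))"
    using gen_binomial_complex[of "- z" "of_real (-l)"] assms unfolding * by simp
  have "summable (\<lambda>k. norm ((of_real (-l) gchoose k) * (- z) ^ k))"
    by (intro abs_summable_in_conv_radius) (use assms in \<open>simp add: conv_radius_gchoose\<close>)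
  then show "summable (\<lambda>k. norm (of_real (pochhammer l k / fact k) * z ^ k))"
    unfolding * .
qed

text \<open>The two factors are complex conjugates, so their product is a squared modulus, and |1 -
  r u|^2 = 1 + r^2 - 2 r x.\<close>

lemma gegpoly_generating_function:
  assumes "\<bar>x\<bar> \<le> 1" "\<bar>r\<bar> < 1"
  shows "(\<lambda>k. r ^ k * gegpoly l k x) sums ((1 + r\<^sup>2 - 2 * r * x) powr (-l))"
proof -
  obtain u :: complex where u: "norm u = 1" "u * cnj u = 1" "u + cnj u = of_real (2 * x)"
    using unit_complex_with_real_part[OF assms(1)] by blast
  let ?a = "\<lambda>z k. of_real (pochhammer l k / fact k) * (of_real r * z) ^ k :: complex"
  let ?w = "1 - of_real r * u"
  have n: "norm (of_real r * u) < 1" "norm (of_real r * cnj u) < 1"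
    using assms u by (simp_all add: norm_mult)
  have "(\<lambda>n. \<Sum>k\<le>n. ?a u k * ?a (cnj u) (n - k)) sums ((\<Sum>k. ?a u k) * (\<Sum>k. ?a (cnj u) k))"
    by (intro Cauchy_product_sums binomial_series_sums(2) n)
  also have "(\<Sum>k. ?a u k) = ?w powr of_real (-l)"
    using binomial_series_sums(1)[OF n(1)] by (rule sums_unique[symmetric])
  also have "(\<Sum>k. ?a (cnj u) k) = cnj ?w powr of_real (-l)"
    using binomial_series_sums(1)[OF n(2)] by (simp add: sums_iff)
  also have "\<dots> = cnj (?w powr of_real (-l))"
  proof (subst cnj_powr)
    \<comment> \<open>Conjugation commutes with the principal power off the negative real
      axis.\<close>
    have "Re ?w > 0" using abs_Re_le_cmod[of "of_real r * u"] n(1) by simp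
    then show "Im ?w = 0 \<Longrightarrow> 0 \<le> Re ?w" by simp
  qed simp_all
  also have "?w powr of_real (-l) * cnj (?w powr of_real (-l)) = of_real ((norm ?w powr (-l))\<^sup>2)"
    by (simp add: complex_norm_square[symmetric] norm_powr_real_powr')
  also have "(norm ?w powr (-l))\<^sup>2 = ((norm ?w)\<^sup>2) powr (-l)"
    by (simp add: power2_eq_square powr_mult)
  also have "(norm ?w)\<^sup>2 = 1 + r\<^sup>2 - 2 * r * x"
  proof -
    have "complex_of_real ((norm ?w)\<^sup>2) = ?w * cnj ?w" by (rule complex_norm_square)
    also have "\<dots> = 1 + of_real (r\<^sup>2) * (u * cnj u) - of_real r * (u + cnj u)"
      by (simp add: algebra_simps power2_eq_square)
    also have "\<dots> = of_real (1 + r\<^sup>2 - 2 * r * x)" unfolding u by simp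
    finally show ?thesis by (simp only: of_real_eq_iff)
  qed
  also have "(\<lambda>n. \<Sum>k\<le>n. ?a u k * ?a (cnj u) (n - k)) = (\<lambda>n. of_real (r ^ n * gegpoly l n x))"
  proof
    fix n
    have "of_real (r ^ n * gegpoly l n x) = of_real r ^ n * (fps_nth (binomial_fps l u * binomial_fps l (cnj u)) n)"
      using binomial_fps_prod_nth[OF u(2,3), of l n] by simp
    also have "\<dots> = (\<Sum>k\<le>n. of_real r ^ n * (of_real (pochhammer l k / fact k) * u ^ k *
          (of_real (pochhammer l (n - k) / fact (n - k)) * cnj u ^ (n - k))))"
      by (simp add: fps_mult_nth binomial_fps_def sum_distrib_left atMost_atLeast0)
    also have "\<dots> = (\<Sum>k\<le>n. ?a u k * ?a (cnj u) (n - k))"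
    proof (intro sum.cong refl)
      fix k assume "k \<in> {..n}"
      then have "of_real r ^ n = (of_real r ^ k * of_real r ^ (n - k) :: complex)"
        by (simp flip: power_add)
      then show "of_real r ^ n * (of_real (pochhammer l k / fact k) * u ^ k *
          (of_real (pochhammer l (n - k) / fact (n - k)) * cnj u ^ (n - k))) = ?a u k * ?a (cnj u) (n - k)"
        by (simp add: power_mult_distrib)
    qed
    finally show "(\<Sum>k\<le>n. ?a u k * ?a (cnj u) (n - k)) = of_real (r ^ n * gegpoly l n x)" ..
  qed
  finally show ?thesis unfolding sums_of_real_iff .
qed

section \<open>Uniqueness of power series coefficients and evaluation of
  \<open>gegenbauer\<close>\<close>

lemma powser_coeff_zero:
  fixes d :: "nat \<Rightarrow> real"
  assumes "\<And>r. \<bar>r\<bar> < 1 \<Longrightarrow> (\<lambda>k. d k * r ^ k) sums 0"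
  shows "d n = 0"
proof (induction n rule: less_induct)
  case (less n)
  \<comment> \<open>With the lower coefficients gone, division by r^n leaves a series with constant
    term \<open>d n\<close>. It sums to 0 for r \<noteq> 0 only, so \<open>d n\<close> is reached as
    a limit.\<close>
  have "(\<lambda>k. d (k + n) * r ^ k) sums 0" if r: "r \<noteq> 0" "norm r < 1" for r
  proof -
    have "(\<lambda>k. d (k + n) * r ^ (k + n)) sums (0 - (\<Sum>k<n. d k * r ^ k))"
      using assms r by (intro sums_split_initial_segment) auto
    then have "(\<lambda>k. d (k + n) * r ^ (k + n) * inverse (r ^ n)) sums (0 * inverse (r ^ n))"
      using less by (intro sums_mult2) auto
    then show ?thesis using r by (simp add: power_add mult.assoc)
  qed
  from powser_limit_0_strong[OF zero_less_one this] have "((\<lambda>_. 0) \<longlongrightarrow> d (0 + n)) (at (0 :: real))" .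
  then show ?case by (simp add: tendsto_const_iff)
qed

lemma powser_coeff_unique:
  fixes a b :: "nat \<Rightarrow> real"
  assumes "\<forall>r\<in>{-1<..<1}. (\<lambda>k. r ^ k * a k) sums f r" "\<forall>r\<in>{-1<..<1}. (\<lambda>k. r ^ k * b k) sums f r"
  shows "a = b"
proof
  fix n
  have "(\<lambda>k. (a k - b k) * r ^ k) sums 0" if "\<bar>r\<bar> < 1" for r
  proof -
    have "(\<lambda>k. r ^ k * a k - r ^ k * b k) sums (f r - f r)"
      using assms that by (intro sums_diff) (auto simp: abs_less_iff)
    then show ?thesis by (simp add: algebra_simps)
  qed
  from powser_coeff_zero[OF this] show "a n = b n" by simp
qed

lemma gegenbauer_eq:
  assumes "l \<noteq> 0" "\<bar>x\<bar> \<le> 1"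
  shows "gegenbauer l n x = gegpoly l n x"
proof -
  have *: "\<forall>r\<in>{-1<..<1}. (\<lambda>k. r ^ k * gegpoly l k x) sums ((1 + r\<^sup>2 - 2 * r * x) powr (-l))"
    using gegpoly_generating_function[OF assms(2)] by (auto simp: abs_less_iff)
  have "(THE c. \<forall>r\<in>{-1<..<1}. (\<lambda>k. r ^ k * c k) sums ((1 + r\<^sup>2 - 2 * r * x) powr (-l))) = (\<lambda>k. gegpoly l k x)"
    by (rule the_equality[where P = "\<lambda>c. \<forall>r\<in>{-1<..<1}. (\<lambda>k. r ^ k * c k) sums ((1 + r\<^sup>2 - 2 * r * x) powr (-l))", OF *])
      (rule powser_coeff_unique[OF _ *])
  then show ?thesis by (simp add: gegenbauer_def assms)
qed

text \<open>At x = 1 the generating function collapses to (1 - r)^(-2l), again a binomial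
  series.\<close>

lemma gegpoly_at_1: "gegpoly l n 1 = pochhammer (2 * l) n / fact n"
proof -
  have "\<forall>r\<in>{-1<..<1}. (\<lambda>k. r ^ k * gegpoly l k 1) sums ((1 - r) powr (-(2 * l)))"
  proof
    fix r :: real assume r: "r \<in> {-1<..<1}"
    have "(1 + r\<^sup>2 - 2 * r * 1) powr (-l) = ((1 - r) * (1 - r)) powr (-l)"
      by (simp add: algebra_simps power2_eq_square)
    also have "\<dots> = (1 - r) powr (-(2 * l))" using r by (simp add: powr_mult flip: powr_add)
    finally show "(\<lambda>k. r ^ k * gegpoly l k 1) sums ((1 - r) powr (-(2 * l)))"
      using gegpoly_generating_function[of 1 r l] r by auto
  qed
  moreover have "\<forall>r\<in>{-1<..<1}. (\<lambda>k. r ^ k * (pochhammer (2 * l) k / fact k)) sums ((1 - r) powr (-(2 * l)))"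
  proof
    fix r :: real assume r: "r \<in> {-1<..<1}"
    have *: "(-(2*l) gchoose k) * (- r) ^ k = r ^ k * (pochhammer (2 * l) k / fact k)" for k
    proof -
      have "(-1) ^ k * (- r) ^ k = r ^ k" by (simp flip: power_mult_distrib)
      then show ?thesis unfolding gbinomial_pochhammer
        by (metis (no_types, lifting) minus_minus mult.assoc mult.commute times_divide_eq_right)
    qed
    show "(\<lambda>k. r ^ k * (pochhammer (2 * l) k / fact k)) sums ((1 - r) powr (-(2 * l)))"
      using gen_binomial_real[of "-r" "-(2*l)"] r unfolding * by (simp add: abs_less_iff)
  qed
  ultimately have "(\<lambda>k. gegpoly l k 1) = (\<lambda>k. pochhammer (2 * l) k / fact k)"
    by (rule powser_coeff_unique)
  then show ?thesis by (rule fun_cong)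
qed

lemma gegpoly_at_1_pos: "l > 0 \<Longrightarrow> gegpoly l n 1 > 0"
  by (simp add: gegpoly_at_1 pochhammer_pos)

section \<open>Positive definiteness\<close>

text \<open>
  A polynomial (or formal power series) in \<open>m + 1\<close> variables is represented by its coefficient
  function on multi-indices.  In this encoding \<open>exp_coeff m x\<close> is the series \<open>exp \<langle>x, y\<rangle>\<close> in \<open>y\<close>,
  \<open>mult_sq\<close> is multiplication by \<open>\<parallel>y\<parallel>^2\<close>, and \<open>fischer m n\<close> is the Fischer inner product on
  the homogeneous component of degree \<open>n\<close>.  Working with the exponential instead of the
  powers of \<open>\<langle>x, y\<rangle>\<close> avoids bookkeeping of degrees.
\<close>

definition multi_indices :: "nat \<Rightarrow> nat \<Rightarrow> (nat \<Rightarrow> nat) set" where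
  "multi_indices m n = {\<alpha>. (\<forall>i>m. \<alpha> i = 0) \<and> (\<Sum>i\<le>m. \<alpha> i) = n}"

definition mfact :: "nat \<Rightarrow> (nat \<Rightarrow> nat) \<Rightarrow> real" where
  "mfact m \<alpha> = (\<Prod>i\<le>m. fact (\<alpha> i))"

definition fischer :: "nat \<Rightarrow> nat \<Rightarrow> ((nat \<Rightarrow> nat) \<Rightarrow> real) \<Rightarrow> ((nat \<Rightarrow> nat) \<Rightarrow> real) \<Rightarrow> real" where
  "fischer m n p q = (\<Sum>\<alpha>\<in>multi_indices m n. mfact m \<alpha> * p \<alpha> * q \<alpha>)"

definition exp_coeff :: "nat \<Rightarrow> (nat \<Rightarrow> real) \<Rightarrow> (nat \<Rightarrow> nat) \<Rightarrow> real" where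
  "exp_coeff m x \<alpha> = (\<Prod>i\<le>m. x i ^ \<alpha> i / fact (\<alpha> i))"

definition mult_sq :: "nat \<Rightarrow> ((nat \<Rightarrow> nat) \<Rightarrow> real) \<Rightarrow> (nat \<Rightarrow> nat) \<Rightarrow> real" where
  "mult_sq m p \<alpha> = (\<Sum>i\<le>m. if \<alpha> i \<ge> 2 then p (\<alpha>(i := \<alpha> i - 2)) else 0)"

definition laplace :: "nat \<Rightarrow> ((nat \<Rightarrow> nat) \<Rightarrow> real) \<Rightarrow> (nat \<Rightarrow> nat) \<Rightarrow> real" where
  "laplace m p \<alpha> = (\<Sum>i\<le>m. (real (\<alpha> i) + 2) * (real (\<alpha> i) + 1) * p (\<alpha>(i := \<alpha> i + 2)))"

section \<open>Multi-index bookkeeping\<close>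

lemma finite_multi_indices [simp]: "finite (multi_indices m n)"
proof (rule finite_subset)
  show "multi_indices m n \<subseteq> {\<alpha>. \<forall>i. (i \<in> {..m} \<longrightarrow> \<alpha> i \<in> {..n}) \<and> (i \<notin> {..m} \<longrightarrow> \<alpha> i = 0)}"
    by (auto simp: multi_indices_def intro: member_le_sum)
  show "finite {\<alpha>. \<forall>i. (i \<in> {..m} \<longrightarrow> \<alpha> i \<in> {..n}) \<and> (i \<notin> {..m} \<longrightarrow> \<alpha> i = (0::nat))}"
    by (rule finite_set_of_finite_funs) auto
qed

lemma sum_fun_upd:
  fixes \<alpha> :: "nat \<Rightarrow> nat"
  assumes "i \<le> m"
  shows "(\<Sum>j\<le>m. (\<alpha>(i := a)) j) = a + (\<Sum>j\<in>{..m} - {i}. \<alpha> j)"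
    and "(\<Sum>j\<le>m. \<alpha> j) = \<alpha> i + (\<Sum>j\<in>{..m} - {i}. \<alpha> j)"
proof -
  have "(\<Sum>j\<le>m. (\<alpha>(i := a)) j) = (\<alpha>(i := a)) i + (\<Sum>j\<in>{..m} - {i}. (\<alpha>(i := a)) j)"
    by (rule sum.remove) (use assms in auto)
  also have "(\<Sum>j\<in>{..m} - {i}. (\<alpha>(i := a)) j) = (\<Sum>j\<in>{..m} - {i}. \<alpha> j)" by (intro sum.cong) auto
  finally show "(\<Sum>j\<le>m. (\<alpha>(i := a)) j) = a + (\<Sum>j\<in>{..m} - {i}. \<alpha> j)" by simp
  show "(\<Sum>j\<le>m. \<alpha> j) = \<alpha> i + (\<Sum>j\<in>{..m} - {i}. \<alpha> j)"
    by (rule sum.remove) (use assms in auto)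
qed

text \<open>The subtraction-free balance of degrees covers raising and lowering an entry
  alike.\<close>

lemma multi_indices_upd:
  fixes \<alpha> :: "nat \<Rightarrow> nat"
  assumes "i \<le> m" "a + n' = \<alpha> i + n" "\<alpha> \<in> multi_indices m n'"
  shows "\<alpha>(i := a) \<in> multi_indices m n"
  using assms sum_fun_upd(1)[OF assms(1), of \<alpha> a] sum_fun_upd(2)[OF assms(1), of \<alpha>] by (auto simp: multi_indices_def)

lemma prod_fun_upd:
  fixes h :: "nat \<Rightarrow> nat \<Rightarrow> real"
  assumes "i \<le> m"
  shows "(\<Prod>j\<le>m. h j ((\<alpha>(i := a)) j)) = h i a * (\<Prod>j\<in>{..m} - {i}. h j (\<alpha> j))"
    and "(\<Prod>j\<le>m. h j (\<alpha> j)) = h i (\<alpha> i) * (\<Prod>j\<in>{..m} - {i}. h j (\<alpha> j))"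
proof -
  have "(\<Prod>j\<le>m. h j ((\<alpha>(i := a)) j)) = h i ((\<alpha>(i := a)) i) * (\<Prod>j\<in>{..m} - {i}. h j ((\<alpha>(i := a)) j))"
    by (rule prod.remove) (use assms in auto)
  also have "(\<Prod>j\<in>{..m} - {i}. h j ((\<alpha>(i := a)) j)) = (\<Prod>j\<in>{..m} - {i}. h j (\<alpha> j))" by (intro prod.cong) auto
  finally show "(\<Prod>j\<le>m. h j ((\<alpha>(i := a)) j)) = h i a * (\<Prod>j\<in>{..m} - {i}. h j (\<alpha> j))" by simp
  show "(\<Prod>j\<le>m. h j (\<alpha> j)) = h i (\<alpha> i) * (\<Prod>j\<in>{..m} - {i}. h j (\<alpha> j))"
    by (rule prod.remove) (use assms in auto)
qed

lemma mfact_upd: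
  assumes "i \<le> m"
  shows "mfact m (\<alpha>(i := \<alpha> i + 2)) = (real (\<alpha> i) + 2) * (real (\<alpha> i) + 1) * mfact m \<alpha>"
  unfolding mfact_def prod_fun_upd[OF assms, where h = "\<lambda>_ k. fact k"] by (simp add: algebra_simps)

section \<open>The Laplacian and multiplication by |y|^2\<close>

lemma exp_coeff_upd:
  assumes "i \<le> m"
  shows "(real (\<alpha> i) + 2) * (real (\<alpha> i) + 1) * exp_coeff m x (\<alpha>(i := \<alpha> i + 2)) = (x i)\<^sup>2 * exp_coeff m x \<alpha>"
proof -
  have *: "(a + 2) * (a + 1) * (x\<^sup>2 * (y / ((a + 2) * ((a + 1) * f)))) = x\<^sup>2 * (y / f)" if "a \<ge> 0"
    for a f x y :: real using that by (simp add: divide_simps)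
  have f: "fact (\<alpha> i + 2) = (real (\<alpha> i) + 2) * ((real (\<alpha> i) + 1) * fact (\<alpha> i))"
    by (simp add: algebra_simps)
  show ?thesis
    unfolding exp_coeff_def prod_fun_upd[OF assms, where h = "\<lambda>j k. x j ^ k / fact k"] f power_add
    using *[of "real (\<alpha> i)" "x i" "x i ^ \<alpha> i" "fact (\<alpha> i)"] by (simp add: mult_ac)
qed

text \<open>For x on the sphere the factor is 1, so the Laplacian fixes the exponential
  series.\<close>

lemma laplace_exp_coeff: "laplace m (exp_coeff m x) \<alpha> = (\<Sum>i\<le>m. (x i)\<^sup>2) * exp_coeff m x \<alpha>"
  unfolding laplace_def sum_distrib_right by (intro sum.cong refl) (simp add: exp_coeff_upd del: add_2_eq_Suc')

text \<open>The Fischer weights are made for this: raising an entry by 2 multiplies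
  \<open>mfact\<close> by the factor that a second derivative produces.\<close>

lemma mult_sq_adjoint:
  "fischer m (n + 2) (mult_sq m p) q = fischer m n p (laplace m q)"
proof -
  have "(\<Sum>\<alpha>\<in>multi_indices m (n + 2). if 2 \<le> \<alpha> i then mfact m \<alpha> * p (\<alpha>(i := \<alpha> i - 2)) * q \<alpha> else 0)
      = (\<Sum>\<alpha>\<in>multi_indices m n. mfact m \<alpha> * p \<alpha> * ((real (\<alpha> i) + 2) * (real (\<alpha> i) + 1) * q (\<alpha>(i := \<alpha> i + 2))))"
    if i: "i \<in> {..m}" for i
  proof -
    have "(\<Sum>\<alpha>\<in>multi_indices m (n + 2). if 2 \<le> \<alpha> i then mfact m \<alpha> * p (\<alpha>(i := \<alpha> i - 2)) * q \<alpha> else 0)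
      = (\<Sum>\<alpha>\<in>{\<alpha>\<in>multi_indices m (n + 2). 2 \<le> \<alpha> i}. mfact m \<alpha> * p (\<alpha>(i := \<alpha> i - 2)) * q \<alpha>)"
      by (simp add: sum.inter_filter)
    also have "\<dots> = (\<Sum>\<alpha>\<in>multi_indices m n. mfact m (\<alpha>(i := \<alpha> i + 2)) * p \<alpha> * q (\<alpha>(i := \<alpha> i + 2)))"
    proof (rule sum.reindex_bij_witness[of _ "\<lambda>\<alpha>. \<alpha>(i := \<alpha> i + 2)" "\<lambda>\<alpha>. \<alpha>(i := \<alpha> i - 2)"])
      show "\<alpha>(i := \<alpha> i - 2) \<in> multi_indices m n" if "\<alpha> \<in> {\<alpha>\<in>multi_indices m (n + 2). 2 \<le> \<alpha> i}" for \<alpha>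
        using that i by (intro multi_indices_upd[where n' = "n + 2"]) auto
      show "\<alpha>(i := \<alpha> i + 2) \<in> {\<alpha>\<in>multi_indices m (n + 2). 2 \<le> \<alpha> i}" if "\<alpha> \<in> multi_indices m n" for \<alpha>
        using that i multi_indices_upd[of i m "\<alpha> i + 2" n \<alpha> "n + 2"] by simp
    qed (simp_all del: add_2_eq_Suc')
    also have "\<dots> = (\<Sum>\<alpha>\<in>multi_indices m n. mfact m \<alpha> * p \<alpha> * ((real (\<alpha> i) + 2) * (real (\<alpha> i) + 1) * q (\<alpha>(i := \<alpha> i + 2))))"
      using i by (intro sum.cong refl) (simp add: mfact_upd del: add_2_eq_Suc')
    finally show ?thesis .
  qed
  then have "(\<Sum>i\<le>m. \<Sum>\<alpha>\<in>multi_indices m (n + 2). if 2 \<le> \<alpha> i then mfact m \<alpha> * p (\<alpha>(i := \<alpha> i - 2)) * q \<alpha> else 0)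
      = (\<Sum>i\<le>m. \<Sum>\<alpha>\<in>multi_indices m n. mfact m \<alpha> * p \<alpha> * ((real (\<alpha> i) + 2) * (real (\<alpha> i) + 1) * q (\<alpha>(i := \<alpha> i + 2))))"
    by (rule sum.cong[OF refl])
  then show ?thesis
    unfolding fischer_def mult_sq_def laplace_def sum_distrib_left sum_distrib_right
    by (subst (1 2) sum.swap) (simp add: if_distrib if_distribR cong: if_cong)
qed

text \<open>The commutator of the Laplacian with |y|^2 is 4 E + 2 (m + 1), where m + 1 counts the
  variables and the Euler operator E acts as n in degree n.\<close>

lemma laplace_mult_sq:
  assumes "\<alpha> \<in> multi_indices m n"
  shows "laplace m (mult_sq m p) \<alpha> = mult_sq m (laplace m p) \<alpha> + (4 * real n + 2 * (real m + 1)) * p \<alpha>"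
proof -
  let ?c = "\<lambda>i. (real (\<alpha> i) + 2) * (real (\<alpha> i) + 1)"
  \<comment> \<open>The mixed terms, differentiating in variable i and multiplying by the square of
    variable j. Those with i \<noteq> j occur on both sides and cancel; the diagonal leaves (a +
    2)(a + 1) - a (a - 1) = 4 a + 2 with a the i-th entry.\<close>
  define D where "D i j = (if 2 \<le> \<alpha> j then ?c i * p (\<alpha>(i := \<alpha> i + 2, j := \<alpha> j - 2)) else 0)" for i j
  have L: "?c i * mult_sq m p (\<alpha>(i := \<alpha> i + 2)) = (\<Sum>j\<in>{..m} - {i}. D i j) + ?c i * p \<alpha>" if "i \<le> m" for i
  proof -
    have "mult_sq m p (\<alpha>(i := \<alpha> i + 2)) = p \<alpha> +
       (\<Sum>j\<in>{..m} - {i}. if 2 \<le> (\<alpha>(i := \<alpha> i + 2)) j then p ((\<alpha>(i := \<alpha> i + 2))(j := (\<alpha>(i := \<alpha> i + 2)) j - 2)) else 0)"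
      unfolding mult_sq_def by (subst sum.remove[of _ i]) (use that in auto)
    also have "(\<Sum>j\<in>{..m} - {i}. if 2 \<le> (\<alpha>(i := \<alpha> i + 2)) j then p ((\<alpha>(i := \<alpha> i + 2))(j := (\<alpha>(i := \<alpha> i + 2)) j - 2)) else 0)
      = (\<Sum>j\<in>{..m} - {i}. if 2 \<le> \<alpha> j then p (\<alpha>(i := \<alpha> i + 2, j := \<alpha> j - 2)) else 0)"
      by (intro sum.cong) auto
    finally have "?c i * mult_sq m p (\<alpha>(i := \<alpha> i + 2)) = ?c i * p \<alpha> +
       (\<Sum>j\<in>{..m} - {i}. ?c i * (if 2 \<le> \<alpha> j then p (\<alpha>(i := \<alpha> i + 2, j := \<alpha> j - 2)) else 0))"
      by (simp only: distrib_left sum_distrib_left)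
    also have "(\<Sum>j\<in>{..m} - {i}. ?c i * (if 2 \<le> \<alpha> j then p (\<alpha>(i := \<alpha> i + 2, j := \<alpha> j - 2)) else 0))
      = (\<Sum>j\<in>{..m} - {i}. D i j)"
      by (intro sum.cong) (auto simp: D_def)
    finally show ?thesis by (simp only: add.commute)
  qed
  have R: "(if 2 \<le> \<alpha> j then laplace m p (\<alpha>(j := \<alpha> j - 2)) else 0) =
      (\<Sum>i\<in>{..m} - {j}. D i j) + real (\<alpha> j) * (real (\<alpha> j) - 1) * p \<alpha>" if "j \<le> m" for j
  proof (cases "2 \<le> \<alpha> j")
    case True
    then have upd: "\<alpha>(j := \<alpha> j - 2, j := (\<alpha>(j := \<alpha> j - 2)) j + 2) = \<alpha>" by (simp del: add_2_eq_Suc')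
    have c: "real ((\<alpha>(j := \<alpha> j - 2)) j) = real (\<alpha> j) - 2" using True by (simp add: of_nat_diff)
    have "laplace m p (\<alpha>(j := \<alpha> j - 2)) = real (\<alpha> j) * (real (\<alpha> j) - 1) * p \<alpha> +
       (\<Sum>i\<in>{..m} - {j}. (real ((\<alpha>(j := \<alpha> j - 2)) i) + 2) * (real ((\<alpha>(j := \<alpha> j - 2)) i) + 1) *
           p ((\<alpha>(j := \<alpha> j - 2))(i := (\<alpha>(j := \<alpha> j - 2)) i + 2)))"
      unfolding laplace_def by (subst sum.remove[of _ j], simp, use that in simp, simp only: c upd) simp
    also have "(\<Sum>i\<in>{..m} - {j}. (real ((\<alpha>(j := \<alpha> j - 2)) i) + 2) * (real ((\<alpha>(j := \<alpha> j - 2)) i) + 1) *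
           p ((\<alpha>(j := \<alpha> j - 2))(i := (\<alpha>(j := \<alpha> j - 2)) i + 2))) = (\<Sum>i\<in>{..m} - {j}. D i j)"
      using True by (intro sum.cong) (auto simp: D_def fun_upd_twist)
    finally show ?thesis using True by (simp only: if_True add.commute)
  next
    case False
    \<comment> \<open>Here the diagonal product a (a - 1) is 0, matching the default value in
      \<open>mult_sq\<close>.\<close>
    then have "real (\<alpha> j) = 0 \<or> real (\<alpha> j) = 1" by auto
    then show ?thesis using False by (auto simp: D_def)
  qed
  have sw: "(\<Sum>i\<le>m. \<Sum>j\<in>{..m} - {i}. D i j) = (\<Sum>j\<le>m. \<Sum>i\<in>{..m} - {j}. D i j)"
  proof -
    have "(\<Sum>i\<le>m. \<Sum>j\<in>{..m} - {i}. D i j) = (\<Sum>i\<le>m. \<Sum>j\<in>{j\<in>{..m}. i \<noteq> j}. D i j)"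
      by (intro sum.cong) auto
    also have "\<dots> = (\<Sum>j\<le>m. \<Sum>i\<in>{i\<in>{..m}. i \<noteq> j}. D i j)"
      by (intro sum.swap_restrict) auto
    also have "\<dots> = (\<Sum>j\<le>m. \<Sum>i\<in>{..m} - {j}. D i j)" by (intro sum.cong) auto
    finally show ?thesis .
  qed
  have n: "(\<Sum>i\<le>m. real (\<alpha> i)) = real n"
    using assms by (auto simp: multi_indices_def)
  have "laplace m (mult_sq m p) \<alpha> - mult_sq m (laplace m p) \<alpha> =
     (\<Sum>i\<le>m. ?c i * p \<alpha> - real (\<alpha> i) * (real (\<alpha> i) - 1) * p \<alpha>)"
  proof -
    have "laplace m (mult_sq m p) \<alpha> = (\<Sum>i\<le>m. (\<Sum>j\<in>{..m} - {i}. D i j) + ?c i * p \<alpha>)"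
      unfolding laplace_def[of m "mult_sq m p"] by (intro sum.cong refl L) simp
    moreover have "mult_sq m (laplace m p) \<alpha> =
       (\<Sum>j\<le>m. (\<Sum>i\<in>{..m} - {j}. D i j) + real (\<alpha> j) * (real (\<alpha> j) - 1) * p \<alpha>)"
      unfolding mult_sq_def[of m "laplace m p"] by (intro sum.cong refl R) simp
    ultimately show ?thesis by (simp only: sum.distrib sw sum_subtractf)
  qed
  also have "\<dots> = (\<Sum>i\<le>m. (4 * real (\<alpha> i) + 2) * p \<alpha>)"
    by (intro sum.cong refl) (simp add: algebra_simps)
  also have "\<dots> = (4 * (\<Sum>i\<le>m. real (\<alpha> i)) + 2 * (real m + 1)) * p \<alpha>"
    by (simp add: sum_distrib_left sum_distrib_right sum.distrib algebra_simps)
  finally show ?thesis unfolding n by simp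
qed

text \<open>The commutator constants depend on the degree, so identities hold one degree at a time;
  this allows them to be used under \<open>mult_sq\<close>.\<close>

lemma mult_sq_cong:
  assumes "\<alpha> \<in> multi_indices m (n + 2)" "\<And>\<beta>. \<beta> \<in> multi_indices m n \<Longrightarrow> p \<beta> = q \<beta>"
  shows "mult_sq m p \<alpha> = mult_sq m q \<alpha>"
  unfolding mult_sq_def
  using assms by (intro sum.cong refl) (auto intro!: assms(2) multi_indices_upd[where n' = "n + 2"])

lemma mult_sq_0:
  assumes "\<alpha> \<in> multi_indices m n" "n < 2"
  shows "mult_sq m p \<alpha> = 0"
  unfolding mult_sq_def
proof (intro sum.neutral ballI)
  fix i assume "i \<in> {..m}"
  then have "\<alpha> i \<le> n" using assms(1) by (auto simp: multi_indices_def intro: member_le_sum)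
  then show "(if 2 \<le> \<alpha> i then p (\<alpha>(i := \<alpha> i - 2)) else 0) = 0" using assms(2) by simp
qed

lemma mult_sq_linear: "mult_sq m (\<lambda>\<alpha>. a * p \<alpha> + b * q \<alpha>) \<alpha> = a * mult_sq m p \<alpha> + b * mult_sq m q \<alpha>"
  unfolding mult_sq_def sum_distrib_left sum.distrib[symmetric] by (intro sum.cong) auto

lemma laplace_sum: "laplace m (\<lambda>\<alpha>. \<Sum>k\<in>K. a k * p k \<alpha>) \<alpha> = (\<Sum>k\<in>K. a k * laplace m (p k) \<alpha>)"
  unfolding laplace_def sum_distrib_left by (subst sum.swap) (simp add: mult_ac)

abbreviation "msq_pow m k \<equiv> (mult_sq m ^^ k)"

lemma msq_pow_0:
  assumes "\<alpha> \<in> multi_indices m n" "n < 2 * k"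
  shows "msq_pow m k p \<alpha> = 0"
  using assms
proof (induction k arbitrary: n \<alpha>)
  case (Suc k)
  show ?case
  proof (cases "n < 2")
    case False
    then obtain n' where n': "n = n' + 2" by (metis add.commute le_Suc_ex linorder_not_less)
    have "mult_sq m (msq_pow m k p) \<alpha> = mult_sq m (\<lambda>_. 0) \<alpha>"
      using Suc n' by (intro mult_sq_cong[of _ _ n']) auto
    also have "\<dots> = 0" by (simp add: mult_sq_def)
    finally show ?thesis by simp
  qed (use Suc mult_sq_0 in auto)
qed simp

text \<open>Moving the Laplacian past k factors |y|^2 yields commutators 4 (n - 2j) + 2 (m + 1) for
  j < k; the constant is their sum. At k = 0 the factor k kills the term with
  \<open>k - 1\<close>.\<close>

lemma laplace_msq_pow:
  assumes "\<alpha> \<in> multi_indices m n" "\<And>\<beta>. laplace m p \<beta> = p \<beta>"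
  shows "laplace m (msq_pow m k p) \<alpha> =
     msq_pow m k p \<alpha> + 2 * real k * (real m + 1 + 2 * real n - 2 * real k + 2) * msq_pow m (k - 1) p \<alpha>"
  using assms(1)
proof (induction k arbitrary: n \<alpha>)
  case (Suc k)
  \<comment> \<open>The constant of the induction hypothesis in degree n - 2. The subtraction is
    real: for n < 2 the term it multiplies, or k itself, is 0.\<close>
  let ?c = "2 * real k * (real m + 1 + 2 * (real n - 2) - 2 * real k + 2)"
  have "mult_sq m (laplace m (msq_pow m k p)) \<alpha> = msq_pow m (Suc k) p \<alpha> + ?c * msq_pow m k p \<alpha>"
  proof (cases "n < 2")
    case True
    have "?c * msq_pow m k p \<alpha> = 0"
    proof (cases "k = 0")
      case False
      then show ?thesis using msq_pow_0[OF Suc.prems, of k p] True by simp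
    qed simp
    then show ?thesis using mult_sq_0[OF Suc.prems True] by simp
  next
    case False
    then obtain n' where n': "n = n' + 2" by (metis add.commute le_Suc_ex linorder_not_less)
    have "mult_sq m (laplace m (msq_pow m k p)) \<alpha> =
       mult_sq m (\<lambda>\<beta>. 1 * msq_pow m k p \<beta> + ?c * msq_pow m (k - 1) p \<beta>) \<alpha>"
      using Suc n' by (intro mult_sq_cong[of _ _ n']) auto
    also have "\<dots> = msq_pow m (Suc k) p \<alpha> + ?c * mult_sq m (msq_pow m (k - 1) p) \<alpha>"
      unfolding mult_sq_linear by simp
    also have "?c * mult_sq m (msq_pow m (k - 1) p) \<alpha> = ?c * msq_pow m k p \<alpha>"
      by (cases k) auto
    finally show ?thesis .
  qed
  then show ?case unfolding funpow.simps o_def laplace_mult_sq[OF Suc.prems]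
    by (simp add: algebra_simps)
qed (simp add: assms)

section \<open>The multinomial theorem and Fischer pairings with exponentials\<close>

lemma exp_coeff_pred:
  assumes "i \<le> m" "\<alpha> i \<noteq> 0"
  shows "real (\<alpha> i) * exp_coeff m u \<alpha> = u i * exp_coeff m u (\<alpha>(i := \<alpha> i - 1))"
proof -
  obtain a where a: "\<alpha> i = Suc a" using assms(2) not0_implies_Suc by blast
  show ?thesis
    unfolding exp_coeff_def prod_fun_upd[OF assms(1), where h = "\<lambda>j k. u j ^ k / fact k"] a
    by (simp add: divide_simps del: of_nat_Suc)
qed

text \<open>The multinomial theorem by Euler's identity: write the degree as the sum of the entries
  and let each entry lower its own exponent by one.\<close>

lemma sum_exp_coeff: "(\<Sum>\<alpha>\<in>multi_indices m n. exp_coeff m u \<alpha>) = (\<Sum>i\<le>m. u i) ^ n / fact n"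
proof (induction n)
  case 0
  have "multi_indices m 0 = {\<lambda>_. 0}" unfolding multi_indices_def by (auto simp: fun_eq_iff) (metis atMost_iff not_le)
  then show ?case by (simp add: exp_coeff_def)
next
  case (Suc n)
  let ?A = "multi_indices m"
  have "real (Suc n) * (\<Sum>\<alpha>\<in>?A (Suc n). exp_coeff m u \<alpha>) = (\<Sum>\<alpha>\<in>?A (Suc n). \<Sum>i\<le>m. real (\<alpha> i) * exp_coeff m u \<alpha>)"
    unfolding sum_distrib_left sum_distrib_right[symmetric] of_nat_sum[symmetric]
    by (intro sum.cong refl) (simp add: multi_indices_def)
  also have "\<dots> = (\<Sum>i\<le>m. \<Sum>\<alpha>\<in>?A (Suc n). real (\<alpha> i) * exp_coeff m u \<alpha>)" by (rule sum.swap)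
  also have "\<dots> = (\<Sum>i\<le>m. \<Sum>\<alpha>\<in>?A n. u i * exp_coeff m u \<alpha>)"
  proof (rule sum.cong[OF refl])
    fix i assume i: "i \<in> {..m}"
    have "(\<Sum>\<alpha>\<in>?A (Suc n). real (\<alpha> i) * exp_coeff m u \<alpha>) =
        (\<Sum>\<alpha>\<in>{\<alpha>\<in>?A (Suc n). \<alpha> i \<noteq> 0}. real (\<alpha> i) * exp_coeff m u \<alpha>)"
      by (rule sum.mono_neutral_right) auto
    also have "\<dots> = (\<Sum>\<alpha>\<in>{\<alpha>\<in>?A (Suc n). \<alpha> i \<noteq> 0}. u i * exp_coeff m u (\<alpha>(i := \<alpha> i - 1)))"
      using i exp_coeff_pred by (intro sum.cong refl) auto
    also have "\<dots> = (\<Sum>\<alpha>\<in>?A n. u i * exp_coeff m u \<alpha>)"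
    proof (rule sum.reindex_bij_witness[of _ "\<lambda>\<alpha>. \<alpha>(i := \<alpha> i + 1)" "\<lambda>\<alpha>. \<alpha>(i := \<alpha> i - 1)"])
      show "\<alpha>(i := \<alpha> i - 1) \<in> ?A n" if "\<alpha> \<in> {\<alpha>\<in>?A (Suc n). \<alpha> i \<noteq> 0}" for \<alpha>
        using that i by (intro multi_indices_upd[where n' = "Suc n"]) auto
      show "\<alpha>(i := \<alpha> i + 1) \<in> {\<alpha>\<in>?A (Suc n). \<alpha> i \<noteq> 0}" if "\<alpha> \<in> ?A n" for \<alpha>
        using that i multi_indices_upd[of i m "\<alpha> i + 1" n \<alpha> "Suc n"] by simp
    qed auto
    finally show "(\<Sum>\<alpha>\<in>?A (Suc n). real (\<alpha> i) * exp_coeff m u \<alpha>) = (\<Sum>\<alpha>\<in>?A n. u i * exp_coeff m u \<alpha>)" .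
  qed
  also have "\<dots> = (\<Sum>i\<le>m. u i) * (\<Sum>\<alpha>\<in>?A n. exp_coeff m u \<alpha>)"
    by (simp only: sum_distrib_left[symmetric] sum_distrib_right[symmetric])
  also have "\<dots> = (\<Sum>i\<le>m. u i) ^ Suc n / fact n" unfolding Suc by simp
  finally show ?case by (simp add: field_simps del: of_nat_Suc)
qed

text \<open>The weight cancels one of the two factorials, leaving the coefficients for the
  componentwise product of x and y.\<close>

lemma fischer_exp_coeff: "fischer m n (exp_coeff m x) (exp_coeff m y) = (\<Sum>i\<le>m. x i * y i) ^ n / fact n"
proof -
  have "mfact m \<alpha> * exp_coeff m x \<alpha> * exp_coeff m y \<alpha> = exp_coeff m (\<lambda>i. x i * y i) \<alpha>" for \<alpha>
    unfolding mfact_def exp_coeff_def prod.distrib[symmetric] by (simp add: power_mult_distrib)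
  then show ?thesis by (simp add: fischer_def sum_exp_coeff)
qed

lemma fischer_sym: "fischer m n p q = fischer m n q p"
  by (simp add: fischer_def mult_ac)

lemma fischer_sum:
  "fischer m n (\<lambda>\<alpha>. \<Sum>k\<in>K. a k * p k \<alpha>) q = (\<Sum>k\<in>K. a k * fischer m n (p k) q)"
  unfolding fischer_def sum_distrib_left sum_distrib_right
  by (subst sum.swap) (simp add: mult_ac)

lemma fischer_cong:
  assumes "\<And>\<alpha>. \<alpha> \<in> multi_indices m n \<Longrightarrow> p \<alpha> = p' \<alpha>" "\<And>\<alpha>. \<alpha> \<in> multi_indices m n \<Longrightarrow> q \<alpha> = q' \<alpha>"
  shows "fischer m n p q = fischer m n p' q'"
  unfolding fischer_def by (intro sum.cong refl) (simp add: assms)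

lemma fischer_0 [simp]: "fischer m n (\<lambda>_. 0) q = 0" "fischer m n p (\<lambda>_. 0) = 0"
  by (simp_all add: fischer_def)

text \<open>Each factor |y|^2 crosses over as a Laplacian, which fixes the exponential of a unit
  vector and only lowers the degree by 2.\<close>

lemma fischer_msq_pow_exp_coeff:
  assumes "(\<Sum>i\<le>m. (y i)\<^sup>2) = 1" "2 * k \<le> n"
  shows "fischer m n (msq_pow m k p) (exp_coeff m y) = fischer m (n - 2 * k) p (exp_coeff m y)"
  using assms(2)
proof (induction k arbitrary: n)
  case (Suc k)
  then obtain n' where n': "n = n' + 2" by (metis add.commute le_add1 le_trans le_Suc_ex mult_Suc_right)
  have "fischer m n (msq_pow m (Suc k) p) (exp_coeff m y) = fischer m n' (msq_pow m k p) (laplace m (exp_coeff m y))"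
    unfolding n' by (simp only: funpow.simps o_def mult_sq_adjoint)
  also have "laplace m (exp_coeff m y) = exp_coeff m y" by (rule ext) (simp add: laplace_exp_coeff assms)
  finally show ?case using Suc n' by simp
qed simp

section \<open>Zonal harmonics and their Gram kernel\<close>

text \<open>
  The degree \<open>n\<close> part of \<open>zonal_harm m l n x\<close> is a multiple of the harmonic projection of
  \<open>\<langle>x, y\<rangle>^n\<close>; the coefficients are forced by the vanishing of the Laplacian and are, up to
  normalisation, those of the Gegenbauer polynomial.
\<close>

definition harm_coeff :: "real \<Rightarrow> nat \<Rightarrow> nat \<Rightarrow> real" where
  "harm_coeff l n k = geg_coeff l n k * 2 ^ (n - 2 * k) * fact (n - 2 * k)"

definition zonal_harm :: "nat \<Rightarrow> real \<Rightarrow> nat \<Rightarrow> (nat \<Rightarrow> real) \<Rightarrow> (nat \<Rightarrow> nat) \<Rightarrow> real" where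
  "zonal_harm m l n x \<alpha> = (\<Sum>k\<le>n. harm_coeff l n k * msq_pow m k (exp_coeff m x) \<alpha>)"

text \<open>The factor of the second summand is the constant of \<open>laplace_msq_pow\<close> for
  power k + 1 in degree n - 2, with m = 2 l + 1.\<close>

lemma harm_coeff_rec:
  assumes "2 * k + 2 \<le> n"
  shows "harm_coeff l n k + 4 * real (Suc k) * (l + real n - 1 - real k) * harm_coeff l n (Suc k) = 0"
proof -
  obtain j where n: "n = 2 * k + 2 + j" using assms le_Suc_ex by blast
  have e: "n - k = Suc (k + j + 1)" "n - Suc k = k + j + 1" "n - 2 * k = j + 2" "n - 2 * Suc k = j"
    using n by auto
  define p where "p = pochhammer l (k + j + 1)"
  have a1: "harm_coeff l n k = (-1) ^ k * (p * (l + real (k + j + 1))) / fact k * 2 ^ j * 4"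
    unfolding harm_coeff_def geg_coeff_def e pochhammer_Suc p_def[symmetric] using assms
    by (simp add: power_add del: fact_Suc)
  have a2: "harm_coeff l n (Suc k) = - ((-1) ^ k * p) / (real (Suc k) * fact k) * 2 ^ j"
    unfolding harm_coeff_def geg_coeff_def e p_def[symmetric] using assms by simp
  have a3: "l + real n - 1 - real k = l + real (k + j + 1)" using n by simp
  show ?thesis unfolding a1 a2 a3 by (simp add: divide_simps del: of_nat_Suc)
qed

lemma laplace_zonal_harm:
  assumes x: "(\<Sum>i\<le>m. (x i)\<^sup>2) = 1" and l: "real m = 2 * l + 1" and \<alpha>: "\<alpha> \<in> multi_indices m n"
  shows "laplace m (zonal_harm m l (n + 2) x) \<alpha> = 0"
proof -
  let ?a = "harm_coeff l (n + 2)" and ?e = "\<lambda>k. msq_pow m k (exp_coeff m x) \<alpha>"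
  have eq: "laplace m (msq_pow m k (exp_coeff m x)) \<alpha> =
     ?e k + 2 * real k * (real m + 1 + 2 * real n - 2 * real k + 2) * ?e (k - 1)" for k
    by (rule laplace_msq_pow[OF \<alpha>]) (simp add: laplace_exp_coeff x)
  have "laplace m (zonal_harm m l (n + 2) x) \<alpha> = (\<Sum>k\<le>Suc (n + 1). ?a k * laplace m (msq_pow m k (exp_coeff m x)) \<alpha>)"
  proof -
    have "zonal_harm m l (n + 2) x = (\<lambda>\<alpha>. \<Sum>k\<le>Suc (n + 1). ?a k * msq_pow m k (exp_coeff m x) \<alpha>)"
      by (simp add: zonal_harm_def fun_eq_iff del: sum.atMost_Suc funpow.simps)
    then show ?thesis by (simp only: laplace_sum)
  qed
  also have "\<dots> = (\<Sum>k\<le>Suc (n + 1). ?a k * ?e k) +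
      (\<Sum>k\<le>Suc (n + 1). ?a k * (2 * real k * (real m + 1 + 2 * real n - 2 * real k + 2) * ?e (k - 1)))"
    by (simp only: eq distrib_left sum.distrib)
  \<comment> \<open>The top power of |y|^2 exceeds the degree n; in the other sum the term k = 0 has
    factor 0, so shifting the index loses nothing.\<close>
  also have "(\<Sum>k\<le>Suc (n + 1). ?a k * ?e k) = (\<Sum>k\<le>n + 1. ?a k * ?e k)"
    using msq_pow_0[OF \<alpha>, of "Suc (n + 1)" "exp_coeff m x"] by (simp del: funpow.simps)
  also have "(\<Sum>k\<le>Suc (n + 1). ?a k * (2 * real k * (real m + 1 + 2 * real n - 2 * real k + 2) * ?e (k - 1)))
     = (\<Sum>k\<le>n + 1. ?a (Suc k) * (2 * real (Suc k) * (real m + 1 + 2 * real n - 2 * real (Suc k) + 2) * ?e k))"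
    by (subst sum.atMost_Suc_shift) simp
  also have "(\<Sum>k\<le>n + 1. ?a k * ?e k) + \<dots> =
     (\<Sum>k\<le>n + 1. (?a k + 4 * real (Suc k) * (l + real (n + 2) - 1 - real k) * ?a (Suc k)) * ?e k)"
    unfolding sum.distrib[symmetric] by (intro sum.cong refl) (simp add: l algebra_simps)
  also have "\<dots> = 0"
  proof (intro sum.neutral ballI)
    fix k
    show "(?a k + 4 * real (Suc k) * (l + real (n + 2) - 1 - real k) * ?a (Suc k)) * ?e k = 0"
    proof (cases "2 * k + 2 \<le> n + 2")
      case True
      then show ?thesis by (simp only: harm_coeff_rec mult_zero_left)
    qed (use msq_pow_0[OF \<alpha>, of k] in simp)
  qed
  finally show ?thesis .
qed

text \<open>
  Harmonic polynomials are orthogonal to multiples of \<open>\<parallel>y\<parallel>^2\<close>, so only the leading term of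
  the first argument contributes, and pairing with it evaluates the second argument.
\<close>

lemma fischer_zonal_harm:
  assumes x: "(\<Sum>i\<le>m. (x i)\<^sup>2) = 1" and y: "(\<Sum>i\<le>m. (y i)\<^sup>2) = 1" and l: "real m = 2 * l + 1"
  shows "fischer m n (zonal_harm m l n x) (zonal_harm m l n y) = harm_coeff l n 0 * gegpoly l n (\<Sum>i\<le>m. x i * y i)"
proof -
  let ?t = "\<Sum>i\<le>m. y i * x i"
  have orth: "fischer m n (msq_pow m (Suc k) (exp_coeff m x)) (zonal_harm m l n y) = 0" for k
  proof (cases "n < 2")
    case True
    then have "fischer m n (msq_pow m (Suc k) (exp_coeff m x)) (zonal_harm m l n y) = fischer m n (\<lambda>_. 0) (zonal_harm m l n y)"
      by (intro fischer_cong refl) (use mult_sq_0 in auto)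
    then show ?thesis by simp
  next
    case False
    then obtain n' where n': "n = n' + 2" by (metis add.commute le_Suc_ex linorder_not_less)
    have "fischer m n (msq_pow m (Suc k) (exp_coeff m x)) (zonal_harm m l n y) =
       fischer m n' (msq_pow m k (exp_coeff m x)) (laplace m (zonal_harm m l n y))"
      unfolding n' funpow.simps o_def mult_sq_adjoint ..
    also have "\<dots> = fischer m n' (msq_pow m k (exp_coeff m x)) (\<lambda>_. 0)"
      unfolding n' by (intro fischer_cong refl laplace_zonal_harm[OF y l])
    finally show ?thesis by simp
  qed
  have "fischer m n (zonal_harm m l n x) (zonal_harm m l n y) =
     (\<Sum>k\<le>n. harm_coeff l n k * fischer m n (msq_pow m k (exp_coeff m x)) (zonal_harm m l n y))"
    unfolding zonal_harm_def[of m l n x] by (rule fischer_sum)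
  also have "\<dots> = (\<Sum>k\<in>{0}. harm_coeff l n k * fischer m n (msq_pow m k (exp_coeff m x)) (zonal_harm m l n y))"
  proof (intro sum.mono_neutral_right ballI)
    fix k assume "k \<in> {..n} - {0}"
    then obtain k' where "k = Suc k'" by (cases k) auto
    then show "harm_coeff l n k * fischer m n (msq_pow m k (exp_coeff m x)) (zonal_harm m l n y) = 0"
      by (simp only: orth mult_zero_right)
  qed auto
  also have "\<dots> = harm_coeff l n 0 * fischer m n (zonal_harm m l n y) (exp_coeff m x)"
    by (simp add: fischer_sym[of m n "exp_coeff m x"])
  also have "fischer m n (zonal_harm m l n y) (exp_coeff m x) =
      (\<Sum>k\<le>n. harm_coeff l n k * fischer m n (msq_pow m k (exp_coeff m y)) (exp_coeff m x))"
    unfolding zonal_harm_def by (rule fischer_sum)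
  also have "\<dots> = gegpoly l n ?t"
    unfolding gegpoly_def
  proof (intro sum.cong refl)
    fix k
    show "harm_coeff l n k * fischer m n (msq_pow m k (exp_coeff m y)) (exp_coeff m x) = geg_coeff l n k * (2 * ?t) ^ (n - 2 * k)"
    proof (cases "2 * k \<le> n")
      case True
      then show ?thesis unfolding fischer_msq_pow_exp_coeff[OF x True] fischer_exp_coeff
        by (simp add: harm_coeff_def power_mult_distrib)
    qed (simp add: harm_coeff_def geg_coeff_def)
  qed
  finally show ?thesis by (simp add: mult.commute)
qed

text \<open>By bilinearity this is the Fischer square of a single combination, a sum of squares with
  positive weights.\<close>

lemma fischer_gram_nonneg: "(\<Sum>i\<in>I. \<Sum>j\<in>I. c i * c j * fischer m n (h i) (h j)) \<ge> 0"
proof -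
  have "(\<Sum>i\<in>I. \<Sum>j\<in>I. c i * c j * fischer m n (h i) (h j)) =
     fischer m n (\<lambda>\<alpha>. \<Sum>i\<in>I. c i * h i \<alpha>) (\<lambda>\<alpha>. \<Sum>j\<in>I. c j * h j \<alpha>)"
    unfolding fischer_sum by (subst fischer_sym, unfold fischer_sum sum_distrib_left)
      (simp add: fischer_sym mult_ac)
  also have "\<dots> \<ge> 0"
    unfolding fischer_def mfact_def
    by (intro sum_nonneg) (simp add: mult.assoc prod_nonneg)
  finally show ?thesis .
qed

lemma gegpoly_positive_definite:
  assumes "real m = 2 * l + 1" "l > 0" "\<And>i. i \<in> I \<Longrightarrow> (\<Sum>k\<le>m. (x i k)\<^sup>2) = 1"
  shows "(\<Sum>i\<in>I. \<Sum>j\<in>I. c i * c j * gegpoly l n (\<Sum>k\<le>m. x i k * x j k)) \<ge> 0"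
proof -
  have pos: "harm_coeff l n 0 > 0"
    using assms(2) by (simp add: harm_coeff_def geg_coeff_def pochhammer_pos)
  have "0 \<le> (\<Sum>i\<in>I. \<Sum>j\<in>I. c i * c j * fischer m n (zonal_harm m l n (x i)) (zonal_harm m l n (x j)))"
    by (rule fischer_gram_nonneg)
  also have "\<dots> = (\<Sum>i\<in>I. \<Sum>j\<in>I. harm_coeff l n 0 * (c i * c j * gegpoly l n (\<Sum>k\<le>m. x i k * x j k)))"
    by (intro sum.cong refl) (simp add: fischer_zonal_harm assms)
  also have "\<dots> = harm_coeff l n 0 * (\<Sum>i\<in>I. \<Sum>j\<in>I. c i * c j * gegpoly l n (\<Sum>k\<le>m. x i k * x j k))"
    by (simp only: sum_distrib_left)
  finally show ?thesis using pos by (simp add: zero_le_mult_iff)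
qed

section \<open>Zonal series\<close>

text \<open>
  The normalised Gegenbauer function, extended from \<open>[0, \<pi>]\<close> to an even function on the whole
  line, so that derivatives at the end points need no special treatment.
\<close>

definition zonal :: "nat \<Rightarrow> nat \<Rightarrow> real \<Rightarrow> real" where
  "zonal d n \<theta> = (if d = 1 then cos (real n * \<theta>)
     else gegpoly ((real d - 1) / 2) n (cos \<theta>) / gegpoly ((real d - 1) / 2) n 1)"

lemma zonal_eq_gegenbauer:
  assumes "d \<ge> 1" "\<theta> \<in> {0..pi}"
  shows "gegenbauer ((real d - 1) / 2) n (cos \<theta>) / gegenbauer ((real d - 1) / 2) n 1 = zonal d n \<theta>"
proof (cases "d = 1")
  case True
  then show ?thesis using assms by (simp add: gegenbauer_def zonal_def arccos_cos)
next
  case False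
  then have "(real d - 1) / 2 \<noteq> 0" using assms by simp
  then show ?thesis using False by (simp add: gegenbauer_eq zonal_def)
qed

lemma zonal_bound:
  assumes "d \<ge> 1"
  shows "\<bar>zonal d n \<theta>\<bar> \<le> 1"
proof (cases "d = 1")
  case False
  then have l: "(real d - 1) / 2 > 0" using assms by simp
  show ?thesis
    using gegpoly_bound[OF _ l, of "cos \<theta>" n] gegpoly_at_1_pos[OF l, of n] False
    by (simp add: zonal_def abs_divide)
qed (simp add: zonal_def)

lemma zonal_at_0 [simp]:
  assumes "d \<ge> 1"
  shows "zonal d n 0 = 1"
proof (cases "d = 1")
  case False
  then show ?thesis
    using gegpoly_at_1_pos[of "(real d - 1) / 2" n] assms by (simp add: zonal_def)
qed (simp add: zonal_def)

lemma zonal_0 [simp]: "zonal d 0 \<theta> = 1"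
  by (simp add: zonal_def)

lemma zonal_minus [simp]: "zonal d n (- \<theta>) = zonal d n \<theta>"
  by (simp add: zonal_def)

text \<open>For l = 1 these are the Chebyshev polynomials of the second kind; they give the
  derivative of cos (n \<theta>), the case d = 1 of the descente.\<close>

lemma sin_Suc_mult: "sin (real (Suc n) * \<theta>) = sin \<theta> * gegpoly 1 n (cos \<theta>)"
proof -
  have rec: "gegpoly 1 (n + 2) x = 2 * x * gegpoly 1 (n + 1) x - gegpoly 1 n x" for n x
  proof -
    have "real (n + 2) * gegpoly 1 (n + 2) x = real (n + 2) * (2 * x * gegpoly 1 (n + 1) x - gegpoly 1 n x)"
      unfolding gegpoly_rec by (simp add: algebra_simps)
    then show ?thesis by (simp only: mult_cancel_left of_nat_eq_0_iff) simp
  qed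
  have "sin (real (Suc n) * \<theta>) = sin \<theta> * gegpoly 1 n (cos \<theta>) \<and>
     sin (real (Suc (Suc n)) * \<theta>) = sin \<theta> * gegpoly 1 (Suc n) (cos \<theta>)"
  proof (induction n)
    case 0
    show ?case using sin_double[of \<theta>] by simp
  next
    case (Suc n)
    let ?t = "real (Suc (Suc n)) * \<theta>"
    have "sin (real (Suc (Suc (Suc n))) * \<theta>) = sin (?t + \<theta>)" by (simp add: algebra_simps)
    moreover have "sin (real (Suc n) * \<theta>) = sin (?t - \<theta>)" by (simp add: algebra_simps)
    ultimately have "sin (real (Suc (Suc (Suc n))) * \<theta>) = 2 * cos \<theta> * sin ?t - sin (real (Suc n) * \<theta>)"
      by (simp add: sin_add sin_diff)
    also have "\<dots> = sin \<theta> * gegpoly 1 (n + 2) (cos \<theta>)"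
      using Suc unfolding rec by (simp add: algebra_simps del: of_nat_Suc)
    finally show ?case using Suc by simp
  qed
  then show ?thesis by blast
qed

lemma zonal_deriv:
  assumes "d \<ge> 1"
  shows "(zonal d (Suc n) has_real_derivative
     - (sin \<theta> * (real (n + 1) * real (n + d) / real d * zonal (d + 2) n \<theta>))) (at \<theta>)"
proof (cases "d = 1")
  case True
  have g1: "gegpoly 1 n 1 = real n + 1"
  proof -
    have "pochhammer 2 n = (fact (n + 1) :: real)"
      using pochhammer_rec[of "1::real" n] by (simp add: pochhammer_fact[symmetric] del: fact_Suc)
    then show ?thesis by (simp add: gegpoly_at_1)
  qed
  have "((\<lambda>\<theta>. cos (real (Suc n) * \<theta>)) has_real_derivative - (real (Suc n) * sin (real (Suc n) * \<theta>))) (at \<theta>)"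
    by (auto intro!: derivative_eq_intros)
  also have "real (Suc n) * sin (real (Suc n) * \<theta>) =
     sin \<theta> * (real (n + 1) * real (n + d) / real d * zonal (d + 2) n \<theta>)"
    unfolding sin_Suc_mult using True g1 by (simp add: zonal_def field_simps)
  also have "(\<lambda>\<theta>. cos (real (Suc n) * \<theta>)) = zonal d (Suc n)"
    using True by (simp add: zonal_def fun_eq_iff)
  finally show ?thesis .
next
  case False
  define l where "l = (real d - 1) / 2"
  have d: "real d = 2 * l + 1" by (simp add: l_def diff_divide_distrib)
  have l: "l > 0" "l \<noteq> 0" using False assms by (auto simp: l_def)
  have l': "(real (d + 2) - 1) / 2 = l + 1" by (simp add: d)
  have pos: "gegpoly l (Suc n) 1 > 0" "gegpoly (l + 1) n 1 > 0"
    using l by (simp_all add: gegpoly_at_1_pos)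
  \<comment> \<open>The ratio of the two normalisations. It follows by expanding
    \<open>pochhammer (2 * l) (n + 2)\<close> once from the front, by two factors, and once from the
    end, by one.\<close>
  have key: "2 * l / gegpoly l (Suc n) 1 = real (n + 1) * real (n + d) / real d / gegpoly (l + 1) n 1"
  proof -
    define p where "p = pochhammer (2 * l) (Suc n)"
    define q where "q = pochhammer (2 * (l + 1)) n"
    have pq: "p \<noteq> 0" "q \<noteq> 0"
      using pochhammer_pos[of "2 * l" "Suc n"] pochhammer_pos[of "2 * (l + 1)" n] l by (auto simp: p_def q_def)
    have "pochhammer (2 * l) (Suc (Suc n)) = 2 * l * ((2 * l + 1) * q)"
      unfolding q_def by (simp only: pochhammer_rec) (simp add: algebra_simps)
    moreover have "pochhammer (2 * l) (Suc (Suc n)) = p * (2 * l + real (Suc n))"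
      unfolding p_def by (rule pochhammer_Suc)
    moreover have "2 * l + real (Suc n) = real (n + d)" using d by simp
    ultimately have "2 * l * (real d * q) = real (n + d) * p"
      by (simp only: d[symmetric] mult.commute[of p])
    moreover have "real d * q \<noteq> 0" using pq d l by simp
    ultimately have "2 * l / p = real (n + d) / (real d * q)"
      using pq(1) by (intro frac_eq_eq[THEN iffD2])
    moreover have "2 * l / gegpoly l (Suc n) 1 = real (n + 1) * fact n * (2 * l / p)"
      unfolding gegpoly_at_1 p_def[symmetric] fact_Suc
      by (simp only: divide_divide_eq_right times_divide_eq_right mult_ac of_nat_id Suc_eq_plus1)
    moreover have "real (n + 1) * real (n + d) / real d / gegpoly (l + 1) n 1 =
        real (n + 1) * fact n * (real (n + d) / (real d * q))"
      unfolding gegpoly_at_1 q_def[symmetric]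
      by (simp only: divide_divide_eq_right divide_divide_eq_left times_divide_eq_right times_divide_eq_left mult_ac)
    ultimately show ?thesis by (simp only:)
  qed
  have "(zonal d (Suc n) has_real_derivative
     2 * l * gegpoly (l + 1) n (cos \<theta>) * (- sin \<theta>) / gegpoly l (Suc n) 1) (at \<theta>)"
  proof -
    have "((\<lambda>\<theta>. gegpoly l (Suc n) (cos \<theta>) / gegpoly l (Suc n) 1) has_real_derivative
     2 * l * gegpoly (l + 1) n (cos \<theta>) * (- sin \<theta>) / gegpoly l (Suc n) 1) (at \<theta>)"
      by (intro DERIV_cdivide DERIV_chain2[OF gegpoly_deriv] DERIV_cos)
    moreover have "zonal d (Suc n) = (\<lambda>\<theta>. gegpoly l (Suc n) (cos \<theta>) / gegpoly l (Suc n) 1)"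
      using False by (simp add: zonal_def l_def fun_eq_iff)
    ultimately show ?thesis by simp
  qed
  also have "2 * l * gegpoly (l + 1) n (cos \<theta>) * (- sin \<theta>) / gegpoly l (Suc n) 1 =
     - (sin \<theta> * gegpoly (l + 1) n (cos \<theta>) * (2 * l / gegpoly l (Suc n) 1))" by simp
  also have "\<dots> = - (sin \<theta> * (real (n + 1) * real (n + d) / real d * zonal (d + 2) n \<theta>))"
    unfolding key zonal_def l' by simp
  finally show ?thesis .
qed

lemma isCont_zonal:
  assumes "d \<ge> 1"
  shows "isCont (zonal d n) \<theta>"
proof (cases n)
  case 0
  then have "zonal d n = (\<lambda>_. 1)" by auto
  then show ?thesis by simp
qed (use zonal_deriv[OF assms] DERIV_isCont in blast)

section \<open>Series of zonal functions\<close>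

lemma summable_zonal:
  assumes "d \<ge> 1" "\<And>n. a n \<ge> 0" "summable a"
  shows "summable (\<lambda>n. a n * zonal d n \<theta>)"
proof (rule summable_comparison_test')
  show "norm (a n * zonal d n \<theta>) \<le> a n" for n
    using zonal_bound[OF assms(1), of n \<theta>] assms(2)[of n] by (simp add: abs_mult mult_left_le)
qed fact

lemma isCont_zonal_series:
  assumes "d \<ge> 1" "\<And>n. a n \<ge> 0" "summable a"
  shows "isCont (\<lambda>\<theta>. \<Sum>n. a n * zonal d n \<theta>) \<theta>"
proof -
  have "uniform_limit UNIV (\<lambda>n \<theta>. \<Sum>i<n. a i * zonal d i \<theta>) (\<lambda>\<theta>. \<Sum>n. a n * zonal d n \<theta>) sequentially"
  proof (rule Weierstrass_m_test)
    show "norm (a n * zonal d n \<theta>) \<le> a n" for n \<theta>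
      using zonal_bound[OF assms(1), of n \<theta>] assms(2)[of n] by (simp add: abs_mult mult_left_le)
  qed fact
  moreover have "\<forall>\<^sub>F n in sequentially. continuous_on UNIV (\<lambda>\<theta>. \<Sum>i<n. a i * zonal d i \<theta>)"
    by (intro always_eventually allI continuous_on_sum continuous_on_mult_left
         continuous_at_imp_continuous_on ballI isCont_zonal assms)
  ultimately have "continuous_on UNIV (\<lambda>\<theta>. \<Sum>n. a n * zonal d n \<theta>)"
    by (intro uniform_limit_theorem[OF _ _ trivial_limit_sequentially])
  then show ?thesis by (simp add: continuous_on_eq_continuous_at)
qed

lemma zonal_positive_definite:
  assumes "d \<ge> 2"
  shows "positive_definite_on (topspace (nsphere d)) (\<lambda>x y. zonal d n (geodesic_dist d x y))"
  unfolding positive_definite_on_def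
proof (intro allI impI)
  fix N :: nat and x :: "nat \<Rightarrow> nat \<Rightarrow> real" and c :: "nat \<Rightarrow> real"
  assume x: "\<forall>i\<in>{1..N}. x i \<in> topspace (nsphere d)"
  define l where "l = (real d - 1) / 2"
  have l: "l > 0" "real d = 2 * l + 1" using assms by (auto simp: l_def field_simps)
  have nrm: "(\<Sum>k\<le>d. (x i k)\<^sup>2) = 1" if "i \<in> {1..N}" for i
    using x that by (auto simp: nsphere)
  have z: "zonal d n (geodesic_dist d (x i) (x j)) = gegpoly l n (\<Sum>k\<le>d. x i k * x j k) / gegpoly l n 1"
    if "i \<in> {1..N}" "j \<in> {1..N}" for i j
  proof -
    have "\<bar>\<Sum>k\<le>d. x i k * x j k\<bar> \<le> 1"
      using Cauchy_Schwarz_ineq_sum[of "x i" "x j" "{..d}"] nrm[OF that(1)] nrm[OF that(2)]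
      by (simp add: abs_square_le_1)
    then show ?thesis using assms by (simp add: zonal_def geodesic_dist_def l_def cos_arccos_abs)
  qed
  have "(\<Sum>i=1..N. \<Sum>j=1..N. c i * c j * zonal d n (geodesic_dist d (x i) (x j))) =
    (\<Sum>i=1..N. \<Sum>j=1..N. c i * c j * gegpoly l n (\<Sum>k\<le>d. x i k * x j k)) / gegpoly l n 1"
    unfolding sum_divide_distrib by (intro sum.cong refl) (simp add: z)
  also have "\<dots> \<ge> 0"
    using l nrm by (intro divide_nonneg_nonneg gegpoly_positive_definite less_imp_le[OF gegpoly_at_1_pos])
  finally show "(\<Sum>i=1..N. \<Sum>j=1..N. c i * c j * zonal d n (geodesic_dist d (x i) (x j))) \<ge> 0" .
qed

lemma geodesic_dist_range:
  assumes "x \<in> topspace (nsphere d)" "y \<in> topspace (nsphere d)"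
  shows "geodesic_dist d x y \<in> {0..pi}"
proof -
  have "(\<Sum>k\<le>d. (x k)\<^sup>2) = 1" "(\<Sum>k\<le>d. (y k)\<^sup>2) = 1" using assms by (auto simp: nsphere)
  then have "\<bar>\<Sum>k\<le>d. x k * y k\<bar> \<le> 1"
    using Cauchy_Schwarz_ineq_sum[of x y "{..d}"] by (simp add: abs_square_le_1)
  then show ?thesis by (auto simp: geodesic_dist_def abs_le_iff intro!: arccos_lbound arccos_ubound)
qed

lemma Psi_of_zonal_series:
  assumes d: "d \<ge> 2" and a: "\<And>n. a n \<ge> 0" "a sums 1"
    and \<psi>: "\<And>\<theta>. \<theta> \<in> {0..pi} \<Longrightarrow> \<psi> \<theta> = (\<Sum>n. a n * zonal d n \<theta>)"
  shows "\<psi> \<in> Psi d"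
proof -
  have sm: "summable a" using a(2) by (rule sums_summable)
  have d1: "d \<ge> 1" using d by simp
  have "continuous_on {0..pi} (\<lambda>\<theta>. \<Sum>n. a n * zonal d n \<theta>)"
    by (intro continuous_at_imp_continuous_on ballI isCont_zonal_series d1 a sm)
  then have "continuous_on {0..pi} \<psi>" by (rule continuous_on_eq) (simp add: \<psi>)
  moreover have "\<psi> 0 = 1" using \<psi>[of 0] d1 a(2) by (simp add: sums_iff)
  moreover have "positive_definite_on (topspace (nsphere d)) (\<lambda>x y. \<psi> (geodesic_dist d x y))"
    unfolding positive_definite_on_def
  proof (intro allI impI)
    fix N :: nat and x :: "nat \<Rightarrow> nat \<Rightarrow> real" and c :: "nat \<Rightarrow> real"
    assume N: "N \<ge> 1" and x: "\<forall>i\<in>{1..N}. x i \<in> topspace (nsphere d)"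
    let ?g = "\<lambda>i j. geodesic_dist d (x i) (x j)"
    have "(\<lambda>n. a n * zonal d n (?g i j)) sums \<psi> (?g i j)" if "i \<in> {1..N}" "j \<in> {1..N}" for i j
    proof -
      have "?g i j \<in> {0..pi}" using x that by (intro geodesic_dist_range) auto
      then show ?thesis using summable_sums[OF summable_zonal[OF d1 a(1) sm]] \<psi> by simp
    qed
    then have sm: "(\<lambda>n. \<Sum>i=1..N. \<Sum>j=1..N. c i * c j * (a n * zonal d n (?g i j)))
        sums (\<Sum>i=1..N. \<Sum>j=1..N. c i * c j * \<psi> (?g i j))"
      by (intro sums_sum sums_mult) auto
    have nn: "0 \<le> (\<Sum>i=1..N. \<Sum>j=1..N. c i * c j * (a n * zonal d n (?g i j)))" for n
    proof -
      have "(\<Sum>i=1..N. \<Sum>j=1..N. c i * c j * (a n * zonal d n (?g i j))) =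
         a n * (\<Sum>i=1..N. \<Sum>j=1..N. c i * c j * zonal d n (?g i j))"
        by (simp add: sum_distrib_left mult_ac)
      moreover have "(\<Sum>i=1..N. \<Sum>j=1..N. c i * c j * zonal d n (?g i j)) \<ge> 0"
        using zonal_positive_definite[OF d, of n] N x unfolding positive_definite_on_def by blast
      ultimately show ?thesis using a(1) by simp
    qed
    show "(\<Sum>i=1..N. \<Sum>j=1..N. c i * c j * \<psi> (?g i j)) \<ge> 0"
      by (rule sums_le[OF nn sums_zero sm])
  qed
  ultimately show ?thesis by (simp add: Psi_def)
qed

lemma zonal_series_deriv:
  assumes d: "d \<ge> 1" and b: "\<And>n. b n \<ge> 0" "summable b"
    and w: "summable (\<lambda>n. b (n + 1) * real (n + 1) * real (n + d))"
  shows "((\<lambda>\<theta>. \<Sum>n. b n * zonal d n \<theta>) has_real_derivative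
    - (sin \<theta> * ((\<Sum>n. b (n + 1) * real (n + 1) * real (n + d) * zonal (d + 2) n \<theta>) / real d))) (at \<theta>)"
proof -
  let ?w = "\<lambda>n. b (n + 1) * real (n + 1) * real (n + d)"
  define f' where "f' n \<theta> = - (sin \<theta> / real d) * (?w n * zonal (d + 2) n \<theta>)" for n \<theta>
  have w0: "?w n \<ge> 0" for n using b(1) by simp
  have sb: "summable (\<lambda>n. b (Suc n))" using b(2) by (subst summable_Suc_iff)
  \<comment> \<open>The weights are their own majorant, as the sine, 1/d and the zonal functions are
    all bounded by 1.\<close>
  have bd: "norm (f' n \<theta>) \<le> ?w n" for n \<theta>
  proof -
    have "\<bar>sin \<theta> / real d\<bar> \<le> 1" using d abs_sin_le_one[of \<theta>]
      by (simp add: divide_le_eq del: abs_sin_le_one)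
    moreover have "\<bar>?w n * zonal (d + 2) n \<theta>\<bar> \<le> ?w n"
      using zonal_bound[of "d + 2" n \<theta>] w0[of n] unfolding abs_mult[of "?w n"] by (simp add: mult_left_le)
    ultimately have "\<bar>sin \<theta> / real d\<bar> * \<bar>?w n * zonal (d + 2) n \<theta>\<bar> \<le> 1 * ?w n"
      by (intro mult_mono) auto
    then show ?thesis
      by (simp only: f'_def real_norm_def abs_mult[of "- (sin \<theta> / real d)"] abs_minus_cancel mult_1)
  qed
  have "((\<lambda>\<theta>. \<Sum>n. b (Suc n) * zonal d (Suc n) \<theta>) has_real_derivative (\<Sum>n. f' n \<theta>)) (at \<theta>)"
  proof -
    have 1: "((\<lambda>\<theta>. b (Suc n) * zonal d (Suc n) \<theta>) has_real_derivative f' n \<theta>) (at \<theta> within UNIV)" for n \<theta>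
      by (rule DERIV_cmult[OF zonal_deriv[OF d], THEN DERIV_cong]) (simp add: f'_def)
    have 2: "uniformly_convergent_on UNIV (\<lambda>n \<theta>. \<Sum>i<n. f' i \<theta>)"
    proof -
      have "uniform_limit UNIV (\<lambda>n \<theta>. \<Sum>i<n. f' i \<theta>) (\<lambda>\<theta>. \<Sum>n. f' n \<theta>) sequentially"
        by (rule Weierstrass_m_test[OF _ w]) (rule bd)
      then show ?thesis by (auto simp: uniformly_convergent_on_def)
    qed
    have 3: "summable (\<lambda>n. b (Suc n) * zonal d (Suc n) 0)" using d sb by simp
    show ?thesis
      by (rule has_field_derivative_series'(2)[OF convex_UNIV 1 2 UNIV_I 3]) simp
  qed
  also have "(\<Sum>n. f' n \<theta>) = - (sin \<theta> / real d) * (\<Sum>n. ?w n * zonal (d + 2) n \<theta>)"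
    unfolding f'_def by (intro suminf_mult summable_zonal w0 w) simp
  finally have "((\<lambda>\<theta>. b 0 + (\<Sum>n. b (Suc n) * zonal d (Suc n) \<theta>)) has_real_derivative
      0 + - (sin \<theta> / real d) * (\<Sum>n. ?w n * zonal (d + 2) n \<theta>)) (at \<theta>)"
    by (intro DERIV_add DERIV_const)
  moreover have "(\<Sum>n. b n * zonal d n \<theta>) = b 0 + (\<Sum>n. b (Suc n) * zonal d (Suc n) \<theta>)" for \<theta>
    using suminf_split_head[OF summable_zonal[OF d b], of \<theta>] by simp
  ultimately show ?thesis by simp
qed

section \<open>Second-order behaviour at 0\<close>

lemma sin_times_deriv_0:
  assumes "isCont h 0"
  shows "((\<lambda>t. - (sin t * h t)) has_real_derivative - h 0) (at (0::real))"
proof -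
  have "((\<lambda>t::real. sin t / t) \<longlongrightarrow> 1) (at 0)"
    using DERIV_sin[of "0::real"] by (simp add: DERIV_def)
  moreover have "(h \<longlongrightarrow> h 0) (at 0)" using assms by (simp add: isCont_def)
  ultimately have "((\<lambda>t. - (sin t / t * h t)) \<longlongrightarrow> - (1 * h 0)) (at 0)" by (intro tendsto_intros)
  then show ?thesis by (simp add: DERIV_def)
qed

text \<open>L'Hopital applies only once because g' is differentiable only at 0; the remaining
  quotient g' t / t is the difference quotient of g' at 0.\<close>

lemma second_order_limit:
  fixes g g' :: "real \<Rightarrow> real"
  assumes ev: "\<forall>\<^sub>F t in nhds 0. (g has_real_derivative g' t) (at t)"
    and "g' 0 = 0" "(g' has_real_derivative s) (at 0)"
  shows "((\<lambda>t. (g t - g 0) / t\<^sup>2) \<longlongrightarrow> s / 2) (at 0)"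
proof (rule lhopital[where f' = g' and g' = "\<lambda>t. 2 * t"])
  have "isCont g 0" using eventually_nhds_x_imp_x[OF ev] DERIV_isCont by blast
  then show "((\<lambda>t. g t - g 0) \<longlongrightarrow> 0) (at 0)" by (simp add: isCont_def LIM_zero)
  show "((\<lambda>t. t\<^sup>2) \<longlongrightarrow> 0) (at (0::real))" by (auto intro!: tendsto_eq_intros)
  show "\<forall>\<^sub>F t in at 0. t\<^sup>2 \<noteq> (0::real)" "\<forall>\<^sub>F t in at 0. 2 * t \<noteq> (0::real)"
    by (auto simp: eventually_at_filter)
  show "\<forall>\<^sub>F t in at 0. ((\<lambda>t. g t - g 0) has_real_derivative g' t) (at t)"
    using ev[unfolded eventually_nhds_conv_at, THEN conjunct1]
    by eventually_elim (auto intro!: derivative_eq_intros)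
  show "\<forall>\<^sub>F t in at 0. ((\<lambda>t. t\<^sup>2) has_real_derivative 2 * t) (at (t::real))"
    by (intro always_eventually allI) (auto intro!: derivative_eq_intros)
  have "((\<lambda>t. (g' (0 + t) - g' 0) / t) \<longlongrightarrow> s) (at 0)" using assms(3) by (simp add: DERIV_def)
  then have "((\<lambda>t. (g' t / t) / 2) \<longlongrightarrow> s / 2) (at 0)" using assms(2) by (intro tendsto_intros) simp_all
  then show "((\<lambda>t. g' t / (2 * t)) \<longlongrightarrow> s / 2) (at 0)" by (simp add: mult.commute)
qed

lemma zonal_second_order:
  assumes "d \<ge> 1"
  shows "((\<lambda>t. (zonal d (Suc n) t - 1) / t\<^sup>2) \<longlongrightarrow> - (real (n + 1) * real (n + d) / real d) / 2) (at 0)"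
proof -
  let ?k = "real (n + 1) * real (n + d) / real d"
  have "isCont (\<lambda>t. ?k * zonal (d + 2) n t) 0"
    by (intro continuous_intros isCont_zonal) simp
  from sin_times_deriv_0[OF this]
  have "((\<lambda>t. - (sin t * (?k * zonal (d + 2) n t))) has_real_derivative - ?k) (at 0)" by simp
  with second_order_limit[of "zonal d (Suc n)" "\<lambda>t. - (sin t * (?k * zonal (d + 2) n t))" "- ?k"]
  show ?thesis using zonal_deriv[OF assms, of n] assms by simp
qed

text \<open>
  Fatou's argument: all terms of \<open>(1 - \<psi> t) / t^2\<close> are nonnegative, so every partial sum
  of the limits of the terms is at most the limit \<open>- \<psi>'' 0 / 2\<close> of the whole.
\<close>

lemma summable_of_second_deriv:
  assumes d: "d \<ge> 1" and b: "\<And>n. b n \<ge> 0" "b sums 1"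
    and E: "\<And>t. \<bar>t\<bar> \<le> pi \<Longrightarrow> even_cont \<psi> t = (\<Sum>n. b n * zonal d n t)"
    and h: "has_second_deriv_at_0 \<psi>"
  shows "summable (\<lambda>n. b (n + 1) * real (n + 1) * real (n + d))"
proof -
  let ?E = "even_cont \<psi>" and ?k = "\<lambda>n. real (n + 1) * real (n + d) / real d"
  have E0: "?E 0 = 1" using E[of 0] d b(2) by (simp add: sums_iff)
  from h have dE: "\<forall>\<^sub>F t in nhds 0. (?E has_real_derivative deriv ?E t) (at t)"
    and ddE: "deriv ?E differentiable (at 0)"
    unfolding has_second_deriv_at_0_def
    by (auto elim!: eventually_mono simp: DERIV_deriv_iff_real_differentiable)
  obtain s where s: "(deriv ?E has_real_derivative s) (at 0)"
    using ddE real_differentiable_def by blast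
  have d0: "(?E has_real_derivative deriv ?E 0) (at 0)" using eventually_nhds_x_imp_x[OF dE] .
  \<comment> \<open>Reflection changes the sign of the derivative at 0 but not the function, so this
    derivative is 0.\<close>
  then have "((\<lambda>t. ?E (- t)) has_real_derivative - deriv ?E 0) (at 0)"
    using DERIV_mirror[where f = ?E and x = 0 and y = "deriv ?E 0"] by simp
  then have "(?E has_real_derivative - deriv ?E 0) (at 0)"
    unfolding even_cont_def[abs_def] abs_minus_cancel .
  then have "deriv ?E 0 = - deriv ?E 0" by (rule DERIV_unique[OF d0])
  then have "deriv ?E 0 = 0" by simp
  from second_order_limit[OF dE this s] E0
  have lim: "((\<lambda>t. (?E t - 1) / t\<^sup>2) \<longlongrightarrow> s / 2) (at 0)" by simp
  have sb: "summable b" using b(2) by (rule sums_summable)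
  have part: "(\<Sum>n<N. b (Suc n) * ?k n) \<le> - s" for N
  proof -
    have "((\<lambda>t. \<Sum>n<N. b (Suc n) * ((zonal d (Suc n) t - 1) / t\<^sup>2)) \<longlongrightarrow>
        (\<Sum>n<N. b (Suc n) * (- ?k n / 2))) (at 0)"
      by (intro tendsto_intros zonal_second_order d)
    moreover have "\<forall>\<^sub>F t in at 0. (?E t - 1) / t\<^sup>2 \<le> (\<Sum>n<N. b (Suc n) * ((zonal d (Suc n) t - 1) / t\<^sup>2))"
    proof -
      have "\<forall>\<^sub>F t in at 0. t \<in> {-pi<..<pi}" by (rule eventually_at_in_open') auto
      then show ?thesis
      proof eventually_elim
        case (elim t)
        have sm: "(\<lambda>n. b n * (1 - zonal d n t)) sums (1 - ?E t)"
        proof -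
          have "(\<lambda>n. b n * zonal d n t) sums ?E t"
            using summable_sums[OF summable_zonal[OF d b(1) sb, of t]] E[of t] elim by (simp add: abs_le_iff)
          from sums_diff[OF b(2) this] show ?thesis by (simp add: algebra_simps)
        qed
        have nn: "b n * (1 - zonal d n t) \<ge> 0" for n
          using b(1)[of n] zonal_bound[OF d, of n t] by (intro mult_nonneg_nonneg) auto
        \<comment> \<open>One more term than N: the term of index 0 vanishes, as
          \<open>zonal d 0\<close> is 1.\<close>
        have "(\<Sum>n<Suc N. b n * (1 - zonal d n t)) \<le> 1 - ?E t"
          using sum_le_suminf[OF sums_summable[OF sm], of "{..<Suc N}"] nn sm by (simp add: sums_iff)
        then have "(\<Sum>n<N. b (Suc n) * (1 - zonal d (Suc n) t)) \<le> 1 - ?E t"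
          by (simp add: sum.lessThan_Suc_shift del: sum.lessThan_Suc)
        then have "(?E t - 1) / t\<^sup>2 \<le> - (\<Sum>n<N. b (Suc n) * (1 - zonal d (Suc n) t)) / t\<^sup>2"
          by (intro divide_right_mono) auto
        also have "\<dots> = (\<Sum>n<N. b (Suc n) * ((zonal d (Suc n) t - 1) / t\<^sup>2))"
          by (simp add: sum_divide_distrib sum_negf[symmetric] right_diff_distrib diff_divide_distrib)
        finally show ?case .
      qed
    qed
    ultimately have "s / 2 \<le> (\<Sum>n<N. b (Suc n) * (- ?k n / 2))"
      using lim tendsto_le[OF at_neq_bot] by blast
    also have "\<dots> = - (\<Sum>n<N. b (Suc n) * ?k n) / 2"
      by (simp add: sum_negf sum_divide_distrib)
    finally show ?thesis by simp
  qed
  have "summable (\<lambda>n. b (Suc n) * ?k n)"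
    by (rule summableI_nonneg_bounded[OF _ part]) (use b(1) in simp)
  then have "summable (\<lambda>n. real d * (b (Suc n) * ?k n))" by (rule summable_mult)
  then show ?thesis using d by (simp add: mult_ac)
qed

section \<open>The descente\<close>

lemma schoenberg_seq_iff_zonal:
  assumes "d \<ge> 1"
  shows "schoenberg_seq d \<psi> b \<longleftrightarrow> (\<forall>n. b n \<ge> 0) \<and> b sums 1 \<and>
     (\<forall>\<theta>\<in>{0..pi}. (\<lambda>n. b n * zonal d n \<theta>) sums \<psi> \<theta>)"
  unfolding schoenberg_seq_def
  by (intro conj_cong refl ball_cong) (simp only: zonal_eq_gegenbauer[OF assms])

lemma G2_finite_iff:
  assumes "\<And>n. b n \<ge> 0"
  shows "G2 d b < \<infinity> \<longleftrightarrow> summable (\<lambda>n. b (n + 1) * real (n + 1) * real (n + d))"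
    and "G2 d b < \<infinity> \<Longrightarrow> enn2real (G2 d b) = (\<Sum>n. b (n + 1) * real (n + 1) * real (n + d))"
proof -
  let ?w = "\<lambda>n. b (n + 1) * real (n + 1) * real (n + d)"
  have w: "?w n \<ge> 0" for n using assms by simp
  have eq: "G2 d b = ennreal (\<Sum>n. ?w n)" if "summable ?w"
    unfolding G2_def by (rule suminf_ennreal2[OF w that])
  show iff: "G2 d b < \<infinity> \<longleftrightarrow> summable ?w"
  proof
    assume "G2 d b < \<infinity>"
    then have "(\<Sum>n. ennreal (?w n)) \<noteq> top" by (simp add: G2_def)
    then show "summable ?w" by (intro summable_suminf_not_top w)
  qed (simp add: eq)
  show "enn2real (G2 d b) = (\<Sum>n. ?w n)" if "G2 d b < \<infinity>"
    using that w unfolding iff by (simp add: eq suminf_nonneg)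
qed

theorem proposition3p4:
  fixes d :: nat and \<psi> :: "real \<Rightarrow> real" and b :: "nat \<Rightarrow> real"
  assumes "d \<ge> 1"
    and "\<psi> \<in> Psi d"
    and "schoenberg_seq d \<psi> b"
    and "\<exists>\<theta>\<in>{0..pi}. \<psi> \<theta> \<noteq> 1"
  shows "((descente_well_defined \<psi> \<and> descente \<psi> \<in> Psi (d + 2)) \<longleftrightarrow> G2 d b < \<infinity>) \<and>
     (G2 d b < \<infinity> \<longrightarrow>
        schoenberg_seq (d + 2) (descente \<psi>)
          (\<lambda>n. b (n + 1) * real (n + 1) * real (n + d) / enn2real (G2 d b))) \<and>
     (G2 d b < \<infinity> \<longleftrightarrow> has_second_deriv_at_0 \<psi>)"
proof -
  define w where "w n = b (n + 1) * real (n + 1) * real (n + d)" for n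
  define f where "f \<theta> = (\<Sum>n. b n * zonal d n \<theta>)" for \<theta>
  define S where "S \<theta> = (\<Sum>n. w n * zonal (d + 2) n \<theta>)" for \<theta>
  define G where "G = (\<Sum>n. w n)"
  have d: "d \<ge> 1" and d2: "d + 2 \<ge> 1" using assms(1) by auto
  have b: "b n \<ge> 0" and b1: "b sums 1" for n
    using assms(3) unfolding schoenberg_seq_iff_zonal[OF d] by blast+
  have sb: "summable b" using b1 by (rule sums_summable)
  have w: "w n \<ge> 0" for n using b by (simp add: w_def)
  have \<psi>_f: "\<psi> \<theta> = f \<theta>" if "\<theta> \<in> {0..pi}" for \<theta>
  proof -
    have "(\<lambda>n. b n * zonal d n \<theta>) sums \<psi> \<theta>"
      using assms(3) that unfolding schoenberg_seq_iff_zonal[OF d] by blast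
    then show ?thesis by (simp add: f_def sums_iff)
  qed
  have E_f: "even_cont \<psi> t = f t" if "\<bar>t\<bar> \<le> pi" for t
  proof -
    have "f \<bar>t\<bar> = f t" by (simp add: f_def abs_if)
    then show ?thesis using \<psi>_f[of "\<bar>t\<bar>"] that by (simp add: even_cont_def)
  qed
  have fin: "G2 d b < \<infinity> \<longleftrightarrow> summable w" and G: "G2 d b < \<infinity> \<Longrightarrow> enn2real (G2 d b) = G"
    using G2_finite_iff[of b d, OF b] by (simp_all add: w_def[abs_def] G_def)
  have G2_of_deriv: "summable w" if "has_second_deriv_at_0 \<psi>"
    using summable_of_second_deriv[OF d b b1 _ that] E_f unfolding w_def f_def by blast
  have of_G2: "has_second_deriv_at_0 \<psi>" "descente_well_defined \<psi>" "descente \<psi> \<in> Psi (d + 2)"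
    "schoenberg_seq (d + 2) (descente \<psi>) (\<lambda>n. w n / G)" if sw: "summable w"
  proof -
    \<comment> \<open>Otherwise all mass sits at index 0 and psi is identically 1.\<close>
    have "\<exists>n. w n \<noteq> 0"
    proof (rule ccontr)
      assume "\<nexists>n. w n \<noteq> 0"
      then have "b (Suc n) = 0" for n using d by (simp add: w_def)
      then have b0: "b n = 0" if "n \<noteq> 0" for n using that by (cases n) auto
      have "b sums (\<Sum>n\<in>{0}. b n)" by (rule sums_finite) (use b0 in auto)
      then have "b 0 = 1" using sums_unique2[OF b1] by simp
      moreover have "(\<lambda>n. b n * zonal d n \<theta>) sums (\<Sum>n\<in>{0}. b n * zonal d n \<theta>)" for \<theta>
        by (rule sums_finite) (use b0 in auto)
      ultimately have "f \<theta> = 1" for \<theta> by (simp add: f_def sums_iff)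
      then show False using assms(4) \<psi>_f by auto
    qed
    then obtain n where "w n > 0" using w by (metis less_eq_real_def)
    then have Gpos: "G > 0" unfolding G_def by (intro suminf_pos2[OF sw w])
    have S0: "S 0 = G" using d2 by (simp add: S_def G_def)
    have cS: "isCont S \<theta>" for \<theta> unfolding S_def[abs_def] by (rule isCont_zonal_series[OF d2 w sw])
    have df: "(f has_real_derivative - (sin \<theta> * (S \<theta> / real d))) (at \<theta>)" for \<theta>
      using zonal_series_deriv[of d b \<theta>, OF d b sb] sw
      unfolding f_def[abs_def] S_def w_def[abs_def] by simp
    \<comment> \<open>Up to the end points the even continuation is f, which is smooth across 0, so
      no one-sided limits arise.\<close>
    have dE: "(even_cont \<psi> has_real_derivative - (sin t * (S t / real d))) (at t)" if "t \<in> {-pi<..<pi}" for t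
      by (rule has_field_derivative_transform_within_open[OF df _ that]) (use E_f in \<open>auto simp: abs_le_iff\<close>)
    have near: "\<forall>\<^sub>F t in nhds 0. t \<in> {-pi<..<pi}" by (rule eventually_nhds_in_open) auto
    have ddE: "(deriv (even_cont \<psi>) has_real_derivative - (G / real d)) (at 0)"
    proof -
      have "((\<lambda>t. - (sin t * (S t / real d))) has_real_derivative - (S 0 / real d)) (at 0)"
        by (rule sin_times_deriv_0) (use cS d in \<open>auto intro!: continuous_intros\<close>)
      then have "(deriv (even_cont \<psi>) has_real_derivative - (S 0 / real d)) (at 0)"
        by (rule has_field_derivative_transform_within_open[where S = "{-pi<..<pi}"])
          (simp_all add: DERIV_imp_deriv[OF dE])
      then show ?thesis by (simp add: S0)
    qed
    have sd: "second_deriv_at_0 \<psi> = - (G / real d)"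
      unfolding second_deriv_at_0_def by (rule DERIV_imp_deriv[OF ddE])
    show h: "has_second_deriv_at_0 \<psi>"
      unfolding has_second_deriv_at_0_def
      using near ddE dE by (auto elim!: eventually_mono simp: real_differentiable_def)
    have "\<psi> differentiable_on {0..pi}"
      unfolding differentiable_on_def
    proof
      fix \<theta> assume \<theta>: "\<theta> \<in> {0..pi}"
      \<comment> \<open>Restricting the globally differentiable f gives the one-sided derivative at
        pi.\<close>
      have "f differentiable (at \<theta> within {0..pi})"
        using df by (meson differentiable_at_withinI real_differentiable_def)
      then show "\<psi> differentiable (at \<theta> within {0..pi})"
        by (rule differentiable_transform_within[OF _ zero_less_one \<theta>]) (simp add: \<psi>_f)
    qed
    then show "descente_well_defined \<psi>"
      using h sd Gpos d by (simp add: descente_well_defined_def)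
    \<comment> \<open>The sine cancels, and both signs and both factors 1/d cancel against psi'' at
      0.\<close>
    have op: "descente_open \<psi> \<theta> = S \<theta> / G" if "\<theta> \<in> {0<..<pi}" for \<theta>
    proof -
      have "(\<psi> has_real_derivative - (sin \<theta> * (S \<theta> / real d))) (at \<theta>)"
        by (rule has_field_derivative_transform_within_open[OF df _ that]) (use \<psi>_f in auto)
      then have "deriv \<psi> \<theta> = - (sin \<theta> * (S \<theta> / real d))" by (rule DERIV_imp_deriv)
      moreover have "sin \<theta> \<noteq> 0" using that sin_gt_zero[of \<theta>] by simp
      ultimately show ?thesis using Gpos d unfolding descente_open_def sd by (simp add: field_simps)
    qed
    have D: "descente \<psi> \<theta> = S \<theta> / G" if "\<theta> \<in> {0..pi}" for \<theta>
    proof (cases "\<theta> \<in> {0<..<pi}")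
      case False
      \<comment> \<open>At an end point the value is a \<open>Lim\<close>; it is determined because
        the end point is a limit point of the interval, and S is continuous there.\<close>
      have "\<theta> \<in> closure {0<..<pi}" using that by simp
      then have nb: "at \<theta> within {0<..<pi} \<noteq> bot"
        using False by (metis at_within_eq_bot_iff Diff_empty Diff_insert0)
      have "((\<lambda>\<theta>. S \<theta> / G) \<longlongrightarrow> S \<theta> / G) (at \<theta> within {0<..<pi})"
        using cS[of \<theta>] Gpos by (intro tendsto_intros) (auto simp: isCont_def intro: tendsto_within_subset)
      then have "(descente_open \<psi> \<longlongrightarrow> S \<theta> / G) (at \<theta> within {0<..<pi})"
        by (rule Lim_transform_eventually) (auto simp: eventually_at_filter op)
      then have "Lim (at \<theta> within {0<..<pi}) (descente_open \<psi>) = S \<theta> / G"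
        by (rule tendsto_Lim[OF nb])
      then show ?thesis using False by (simp add: descente_def del: greaterThanLessThan_iff)
    qed (simp add: descente_def op)
    have ser: "(\<lambda>n. w n / G * zonal (d + 2) n \<theta>) sums descente \<psi> \<theta>" if "\<theta> \<in> {0..pi}" for \<theta>
      using sums_divide[OF summable_sums[OF summable_zonal[OF d2 w sw, of \<theta>]], of G] D[OF that]
      by (simp add: S_def)
    have c: "w n / G \<ge> 0" for n using w Gpos by simp
    have c1: "(\<lambda>n. w n / G) sums 1"
      using sums_divide[OF summable_sums[OF sw], of G] Gpos by (simp add: G_def)
    show "descente \<psi> \<in> Psi (d + 2)"
      using d ser by (intro Psi_of_zonal_series[OF _ c c1]) (auto simp: sums_iff)
    show "schoenberg_seq (d + 2) (descente \<psi>) (\<lambda>n. w n / G)"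
      unfolding schoenberg_seq_iff_zonal[OF d2] using c c1 ser by blast
  qed
  show ?thesis
  proof (intro conjI impI)
    \<comment> \<open>Forwards, the second derivative contained in well-definedness gives
      summability.\<close>
    show "(descente_well_defined \<psi> \<and> descente \<psi> \<in> Psi (d + 2)) \<longleftrightarrow> G2 d b < \<infinity>"
      unfolding fin using of_G2 G2_of_deriv by (auto simp: descente_well_defined_def)
    show "schoenberg_seq (d + 2) (descente \<psi>)
        (\<lambda>n. b (n + 1) * real (n + 1) * real (n + d) / enn2real (G2 d b))" if "G2 d b < \<infinity>"
      using of_G2(4) that unfolding G[OF that] fin w_def by blast
    show "G2 d b < \<infinity> \<longleftrightarrow> has_second_deriv_at_0 \<psi>"
      unfolding fin using of_G2(1) G2_of_deriv by blast
  qed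
qed

end
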